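(* Let $a<b$, $S\in[a,b]$ and $\mu\in\mathbb{R}$. Let $X^{(\mu)}$ be Brownian motion with drift $\mu$, reflected between the boundaries $a$ and $b$, starting from a random position $\eta\in[a,S]$. Suppose that the first-passage time of $X^{(\mu)}$ through $S$ from below has an assigned probability density $f$, and denote by $\widehat f(\theta)=\int_0^\infty e^{-\theta t}f(t)\,dt$, $\theta\ge 0$, its Laplace transform. If there exists a solution $g$ to the inverse first-passage-time (IFPT) problem for $X^{(\mu)}$ relative to $S$ and $f$, then its Laplace transform $\widehat g$ must satisfy, for all $\theta\ge 0$, $$ \widehat f(\theta)=\frac{\theta\, e^{2a\sqrt{\mu^2+2\theta}}\;\widehat g\left(\sqrt{\mu^2+2\theta}+\mu\right)+\left(\mu^2+\theta+\mu\sqrt{\mu^2+2\theta}\right)\widehat g\left(\mu-\sqrt{\mu^2+2\theta}\right)}{\theta\, e^{-S(\sqrt{\mu^2+2\theta}+\mu)}\,e^{2a\sqrt{\mu^2+2\theta}}+\left(\mu^2+\theta+\mu\sqrt{\mu^2+2\theta}\right)e^{S(\sqrt{\mu^2+2\theta}-\mu)}}, $$ where at $\theta=0$ with $\mu\le 0$ (when numerator and denominator both vanish) the right-hand side is understood as its limit as $\theta\to0^+$. In particular, if $\mu=0$ and $g$ is a solution to the IFPT problem for $X^{(0)}$ relative to $S$ and $f$, then $$ \widehat f(\theta)=\frac{\widehat g(\sqrt{2\theta})+\widehat g(-\sqrt{2\theta})\,e^{-2a\sqrt{2\theta}}}{e^{-S\sqrt{2\theta}}+e^{(S-2a)\sqrt{2\theta}}},\qquad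 \theta\ge0 . $$ Furthermore, if $\mu=0$ and if the density $g$ is required to be symmetric with respect to $(a+S)/2$, then $$ \widehat g(\theta)=\frac{e^{-S\theta}+e^{-(2a-S)\theta}}{1+e^{(S-a)\theta}}\;\widehat f\left(\frac{\theta^2}{2}\right),\qquad \theta\ge 0 . $$
   Context: Brownian motion with drift $\mu$ reflected between $a$ and $b$ (also called regulated Brownian motion with drift $\mu$) is the unique strong solution of $$dX(t)=\mu\,dt+dB_t+dL_t-dU_t,\qquad X(0)=\eta,$$ where $B_t$ is a standard Brownian motion, $\eta$ is a random variable independent of $B$, and the regulators $L,U$ are determined by: $L,U$ are continuous, nondecreasing, $L_0=U_0=0$; $X(t)\in[a,b]$ for all $t\ge0$; and $L$ (resp. $U$) increases only when $X=a$ (resp. $X=b$), i.e. $\int_0^t\mathbf 1_{\{X(s)=a\}}dL_s=L_t$ and $\int_0^t\mathbf 1_{\{X(s)=b\}}dU_s=U_t$. The first-passage time (FPT) of $X$ through $S$ from below is $\tau_S=\inf\{t>0: X(t)=S\}$, where $P(a\le\eta\le S)=1$. For fixed $x\in[a,S]$, $\tau_S(x)$ denotes this time conditional on $\eta=x$; it is assumed to be a.s. finite and to possess a density. IFPT problem: given $S$ and a probability density $f$ on $(0,\infty)$, find a probability density $g$, with support $(a,S)$, such that if $\eta$ has density $g$ (and is independent of $B$), then $P(\tau_S\le t)=\int_0^t f(s)\,ds$ for all $t\ge0$. Such a $g$ is called a solution to the IFPT problem. Its (bilateral) Laplace transform is $\widehat g(\theta)=\int_a^S e^{-\theta x}g(x)\,dx$,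 defined for all real $\theta$. *)

theory Defs
  imports "HOL-Probability.Probability"
begin

text \<open>Stochastic processes are functions \<open>real \<Rightarrow> 'w \<Rightarrow> real\<close> of which only the values at times
  \<open>t \<ge> 0\<close> matter.\<close>

locale standard_brownian_motion = prob_space M
  for M :: "'w measure" and B :: "real \<Rightarrow> 'w \<Rightarrow> real" +
  assumes BM_measurable: "0 \<le> t \<Longrightarrow> B t \<in> borel_measurable M"
    and BM_start: "AE \<omega> in M. B 0 \<omega> = 0"
    and BM_continuous: "AE \<omega> in M. continuous_on {0..} (\<lambda>t. B t \<omega>)"
    and BM_normal: "\<lbrakk>0 \<le> s; s < t\<rbrakk> \<Longrightarrow>
      distributed M lborel (\<lambda>\<omega>. B t \<omega> - B s \<omega>) (normal_density 0 (sqrt (t - s)))"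
    and BM_indep_increments: "\<lbrakk>0 \<le> u 0; \<And>i. i < n \<Longrightarrow> u i < u (Suc i)\<rbrakk> \<Longrightarrow>
      indep_vars (\<lambda>_. borel) (\<lambda>i \<omega>. B (u (Suc i)) \<omega> - B (u i) \<omega>) {..<n :: nat}"

definition preimages :: "'w measure \<Rightarrow> ('w \<Rightarrow> real) \<Rightarrow> 'w set set" where
  "preimages M Y = {Y -` A \<inter> space M | A. A \<in> sets borel}"

text \<open>The filtration generated by \<open>\<eta>\<close> and \<open>B\<close>, augmented by the null sets.  A strong solution is,
  by definition, adapted to it.\<close>

definition augmented_filtration ::
  "'w measure \<Rightarrow> ('w \<Rightarrow> real) \<Rightarrow> (real \<Rightarrow> 'w \<Rightarrow> real) \<Rightarrow> real \<Rightarrow> 'w measure" where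
  "augmented_filtration M \<eta> B t =
     sigma (space M) (preimages M \<eta> \<union> (\<Union>s\<in>{0..t}. preimages M (B s)) \<union> null_sets M)"

text \<open>In the last two assumptions a regulator, which vanishes at time 0, is extended by 0 to
  negative times, because \<^const>\<open>interval_measure\<close> needs a nondecreasing function on the whole
  line.  The SDE is stated in integrated form.\<close>

locale reflected_brownian_motion = standard_brownian_motion M B
  for M :: "'w measure" and B :: "real \<Rightarrow> 'w \<Rightarrow> real" +
  fixes \<eta> :: "'w \<Rightarrow> real" and X L U :: "real \<Rightarrow> 'w \<Rightarrow> real" and \<mu> a b :: real
  assumes initial_measurable: "\<eta> \<in> borel_measurable M"
    and initial_indep:
      "indep_set (preimages M \<eta>) (sigma_sets (space M) (\<Union>t\<in>{0..}. preimages M (B t)))"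
    and adapted: "0 \<le> t \<Longrightarrow> X t \<in> borel_measurable (augmented_filtration M \<eta> B t)"
      "0 \<le> t \<Longrightarrow> L t \<in> borel_measurable (augmented_filtration M \<eta> B t)"
      "0 \<le> t \<Longrightarrow> U t \<in> borel_measurable (augmented_filtration M \<eta> B t)"
    and sde: "AE \<omega> in M. \<forall>t\<ge>0. X t \<omega> = \<eta> \<omega> + \<mu> * t + B t \<omega> + L t \<omega> - U t \<omega>"
    and initial: "AE \<omega> in M. X 0 \<omega> = \<eta> \<omega>"
    and range: "AE \<omega> in M. \<forall>t\<ge>0. X t \<omega> \<in> {a..b}"
    and regulators_start: "AE \<omega> in M. L 0 \<omega> = 0 \<and> U 0 \<omega> = 0"
    and regulators_continuous:
      "AE \<omega> in M. continuous_on {0..} (\<lambda>t. L t \<omega>) \<and> continuous_on {0..} (\<lambda>t. U t \<omega>)"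
    and regulators_mono:
      "AE \<omega> in M. mono_on {0..} (\<lambda>t. L t \<omega>) \<and> mono_on {0..} (\<lambda>t. U t \<omega>)"
    and lower_regulator: "AE \<omega> in M. \<forall>t\<ge>0.
      (LINT s:{0..t}|interval_measure (\<lambda>r. L (max 0 r) \<omega>). indicator {r. X r \<omega> = a} s) = L t \<omega>"
    and upper_regulator: "AE \<omega> in M. \<forall>t\<ge>0.
      (LINT s:{0..t}|interval_measure (\<lambda>r. U (max 0 r) \<omega>). indicator {r. X r \<omega> = b} s) = U t \<omega>"

text \<open>The value is \<open>\<infinity>\<close> if the level is never reached.\<close>

definition first_passage_time :: "(real \<Rightarrow> 'w \<Rightarrow> real) \<Rightarrow> real \<Rightarrow> 'w \<Rightarrow> ereal" where
  "first_passage_time X S \<omega> = (INF t\<in>{t. 0 < t \<and> X t \<omega> = S}. ereal t)"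

definition prob_density_on :: "real set \<Rightarrow> (real \<Rightarrow> real) \<Rightarrow> bool" where
  "prob_density_on I h \<longleftrightarrow> h \<in> borel_measurable borel \<and> (\<forall>x. 0 \<le> h x) \<and>
     (\<forall>x. x \<notin> I \<longrightarrow> h x = 0) \<and> (LBINT x. h x) = 1"

text \<open>The law of the first-passage time of the process is given by the density \<open>f\<close>.  As \<open>f\<close>
  has total mass 1, this includes that the first-passage time is almost surely finite.\<close>

definition first_passage_density ::
  "'w measure \<Rightarrow> (real \<Rightarrow> 'w \<Rightarrow> real) \<Rightarrow> real \<Rightarrow> (real \<Rightarrow> real) \<Rightarrow> bool" where
  "first_passage_density M X S f \<longleftrightarrow> prob_density_on {0<..} f \<and>
     first_passage_time X S \<in> borel_measurable M \<and>
     (\<forall>t\<ge>0. measure M {\<omega> \<in> space M. first_passage_time X S \<omega> \<le> ereal t} = (LBINT s:{0..t}. f s))"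

text \<open>\<open>g\<close> solves the inverse first-passage-time problem relative to \<open>S\<close> and \<open>f\<close>, as witnessed by
  the process \<open>X\<close> started from \<open>\<eta>\<close> with density \<open>g\<close>.  The law of \<open>X\<close> is determined by that of
  \<open>\<eta>\<close>, so it is immaterial which realisation \<open>X\<close>, \<open>\<eta>\<close> on which space \<open>M\<close> is used.\<close>

definition ifpt_solution :: "'w measure \<Rightarrow> ('w \<Rightarrow> real) \<Rightarrow> (real \<Rightarrow> 'w \<Rightarrow> real) \<Rightarrow>
    real \<Rightarrow> real \<Rightarrow> (real \<Rightarrow> real) \<Rightarrow> (real \<Rightarrow> real) \<Rightarrow> bool" where
  "ifpt_solution M \<eta> X a S f g \<longleftrightarrow>
     prob_density_on {a<..<S} g \<and> distributed M lborel \<eta> g \<and> first_passage_density M X S f"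

definition laplace_on :: "real set \<Rightarrow> (real \<Rightarrow> real) \<Rightarrow> real \<Rightarrow> real" where
  "laplace_on I h \<theta> = (LBINT x:I. exp (- \<theta> * x) * h x)"

end

theory Submission
  imports Defs "HOL-Real_Asymp.Real_Asymp"
begin

text \<open>Let \<open>u\<close> be a combination of two exponentials that solves \<open>u'' / 2 + \<mu> u' = \<theta> u\<close> with \<open>u'(a) = 0\<close>.
  Before the passage time \<open>\<tau>\<close> through \<open>S \<le> b\<close> the path stays below \<open>b\<close>, so the upper regulator is
  constant, and the lower one grows only at \<open>a\<close>, where \<open>u'\<close> vanishes.  Hence the discounted process
  \<open>exp (- \<theta> t) u (X t)\<close>, stopped at \<open>\<tau>\<close>, should be a bounded martingale, and optional stopping gives
  \<open>E (exp (- \<theta> \<tau>)) u(S) = E (u \<eta>)\<close>.  The left-hand expectation is the Laplace transform of \<open>f\<close>, and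
  the right-hand side is a combination of two values of the Laplace transform of \<open>g\<close>, because \<open>u\<close> is
  a sum of exponentials.  The exponents are \<open>- (r + \<mu>)\<close> and \<open>r - \<mu>\<close> with \<open>r = sqrt (\<mu>\<^sup>2 + 2 \<theta>)\<close>, the
  boundary condition at \<open>a\<close> fixes the ratio of the coefficients, and the quotient of the two sides is
  the asserted formula.  The value at \<open>\<theta> = 0\<close> for \<open>\<mu> \<le> 0\<close> follows by continuity of the Laplace
  transform of \<open>f\<close>, and the symmetric case from \<open>E (exp (\<theta> \<eta>)) = exp ((a + S) \<theta>) E (exp (- \<theta> \<eta>))\<close>.

  The martingale step is proved by discretisation, without stochastic integration.  On the grid
  \<open>t\<^sub>k = k T / n\<close> let \<open>A\<^sub>k\<close> be the event that neither the passage nor the excess of \<open>L\<close> over a fixed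
  bound \<open>K\<close> has occurred by time \<open>t\<^sub>k\<close>.  Since the exponential moments of a Brownian increment are
  known exactly, and \<open>A\<^sub>k\<close> and \<open>X t\<^sub>k\<close> are determined by the past, which is independent of the next
  Brownian increment \<open>\<Delta>B\<close> over the step length \<open>h = T / n\<close>, the stopped sum of the increments of
  the discounted process has the same mean as the stopped sum of the \<^emph>\<open>corrections\<close>
  \<open>exp (- \<theta> t\<^sub>k\<^sub>+\<^sub>1) (u (X t\<^sub>k\<^sub>+\<^sub>1) - u (X t\<^sub>k + \<mu> h + \<Delta>B))\<close>: only what the regulators contribute is left
  (lemma \<open>one_step\<close>).  A correction during the life of the path is at most a modulus of continuity
  times the increment of \<open>L\<close>, since \<open>L\<close> moves only when the path is at \<open>a\<close> and \<open>u'(a) = 0\<close>; these sum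
  to at most \<open>K\<close> times the modulus.  One last correction is of the size of the modulus, too
  (\<open>small_steps_bound\<close>).  Steps in which the Brownian motion moves by more than 1 have total expected
  contribution at most of order \<open>n h\<^sup>2\<close> (\<open>large_step_bound\<close>).  So the mean correction tends to 0
  (\<open>correction_limit\<close>), and letting \<open>n\<close>, then \<open>K\<close>, then \<open>T\<close> tend to infinity gives
  \<open>passage_identity\<close>.\<close>

section \<open>Brownian increments and the past\<close>

text \<open>Completing the square: weighting a centred normal density with an exponential shifts its mean.\<close>

lemma (in prob_space) exp_normal:
  fixes Z :: "'a \<Rightarrow> real" and l \<sigma> :: real
  assumes Z: "distributed M lborel Z (normal_density 0 \<sigma>)" and \<sigma>: "0 < \<sigma>"
  shows integrable_exp_normal: "integrable M (\<lambda>\<omega>. exp (l * Z \<omega>))"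
    and expectation_exp_normal: "expectation (\<lambda>\<omega>. exp (l * Z \<omega>)) = exp (l\<^sup>2 * \<sigma>\<^sup>2 / 2)"
proof -
  have eq: "normal_density 0 \<sigma> x * exp (l * x)
      = exp (l\<^sup>2 * \<sigma>\<^sup>2 / 2) * normal_density (l * \<sigma>\<^sup>2) \<sigma> x" for x
  proof -
    have "- (x - 0)\<^sup>2 / (2 * \<sigma>\<^sup>2) + l * x = l\<^sup>2 * \<sigma>\<^sup>2 / 2 + (- (x - l * \<sigma>\<^sup>2)\<^sup>2 / (2 * \<sigma>\<^sup>2))"
      using \<sigma> by (simp add: field_simps power2_eq_square)
    then have "exp (- (x - 0)\<^sup>2 / (2 * \<sigma>\<^sup>2)) * exp (l * x)
        = exp (l\<^sup>2 * \<sigma>\<^sup>2 / 2) * exp (- (x - l * \<sigma>\<^sup>2)\<^sup>2 / (2 * \<sigma>\<^sup>2))"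
      by (simp only: exp_add[symmetric])
    then show ?thesis
      by (simp add: normal_density_def)
  qed
  have "integrable lborel (\<lambda>x. normal_density 0 \<sigma> x * exp (l * x))"
    using \<sigma> by (simp only: eq) simp
  then show "integrable M (\<lambda>\<omega>. exp (l * Z \<omega>))"
    by (subst (asm) distributed_integrable[OF Z]) auto
  have "expectation (\<lambda>\<omega>. exp (l * Z \<omega>)) = (\<integral>x. normal_density 0 \<sigma> x * exp (l * x) \<partial>lborel)"
    by (subst distributed_integral[OF Z]) auto
  also have "\<dots> = exp (l\<^sup>2 * \<sigma>\<^sup>2 / 2)"
    using \<sigma> by (simp only: eq) simp
  finally show "expectation (\<lambda>\<omega>. exp (l * Z \<omega>)) = exp (l\<^sup>2 * \<sigma>\<^sup>2 / 2)" .
qed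

context standard_brownian_motion
begin

lemma increment_normal:
  assumes "0 \<le> t" "0 < h"
  shows "distributed M lborel (\<lambda>\<omega>. B (t + h) \<omega> - B t \<omega>) (normal_density 0 (sqrt h))"
  using BM_normal[of t "t + h"] assms by simp

text \<open>Sorting the times turns finitely many values up to \<open>t\<close> into partial sums of independent increments,
  of which the increment after \<open>t\<close> is the next one.\<close>

lemma past_values_indep_increment:
  assumes F: "finite F" "F \<subseteq> {0..t}" and t: "0 \<le> t" "0 < h"
    and A: "\<And>s. s \<in> F \<Longrightarrow> A s \<in> sets borel" and D: "D \<in> sets borel"
  shows "prob ({\<omega> \<in> space M. \<forall>s\<in>F. B s \<omega> \<in> A s} \<inter> {\<omega> \<in> space M. B (t + h) \<omega> - B t \<omega> \<in> D})
    = prob {\<omega> \<in> space M. \<forall>s\<in>F. B s \<omega> \<in> A s} * prob {\<omega> \<in> space M. B (t + h) \<omega> - B t \<omega> \<in> D}"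
proof -
  \<comment> \<open>The times 0 and \<open>t\<close> are added so that partial sums of increments give the values \<open>B s\<close> and the
    last increment is the one from \<open>t\<close> to \<open>t + h\<close>.\<close>
  define G where "G = insert 0 (insert t F)"
  define us where "us = sorted_list_of_set G"
  define m where "m = length us"
  define u where "u = (\<lambda>i. if i < m then us ! i else t + h)"
  define Z where "Z = (\<lambda>i \<omega>. B (u (Suc i)) \<omega> - B (u i) \<omega>)"
  have G: "finite G" "0 \<in> G" "t \<in> G" "G \<subseteq> {0..t}"
    using F t by (auto simp: G_def)
  have us: "set us = G" "sorted us" "distinct us"
    using G(1) by (auto simp: us_def)
  have m: "0 < m" using us G unfolding m_def by (cases us) auto
  have mono: "u i < u (Suc i)" if "i < m" for i
  proof (cases "Suc i < m")
    case True
    then show ?thesis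
      using us that strict_sorted_iff[of us] sorted_wrt_nth_less[of "(<)" us i "Suc i"]
      unfolding u_def m_def by simp
  next
    case False
    have "us ! i \<in> G" using that us(1) by (auto simp: m_def)
    then show ?thesis using False that G(4) t by (auto simp: u_def)
  qed
  have nonneg: "0 \<le> u i" for i
  proof (cases "i < m")
    case True
    then have "us ! i \<in> G" using us(1) by (auto simp: m_def)
    then show ?thesis using G(4) True by (auto simp: u_def)
  qed (use t in \<open>auto simp: u_def\<close>)
  have mono': "u i \<le> u j" if "i \<le> j" "j \<le> m" for i j
    using that(1,2)
  proof (induction rule: dec_induct)
    case (step k)
    then show ?case using mono[of k] by auto
  qed simp
  have idx: "\<exists>j<m. u j = s" if "s \<in> G" for s
    using that us(1) by (metis in_set_conv_nth m_def u_def)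
  have u0: "u 0 = 0"
  proof -
    obtain j where "j < m" "u j = 0" using idx G by blast
    then show ?thesis using mono'[of 0 j] nonneg[of 0] by auto
  qed
  have ut: "u (m - 1) = t"
  proof -
    obtain j where j: "j < m" "u j = t" using idx G by blast
    have "u (m - 1) \<in> G" using us(1) m by (auto simp: m_def u_def)
    moreover have "j \<le> m - 1" using j by simp
    ultimately show ?thesis using mono'[of j "m - 1"] j(2) G(4) by auto
  qed
  have um: "u m = t + h" by (simp add: u_def)
  have Zlast: "Z (m - 1) \<omega> = B (t + h) \<omega> - B t \<omega>" for \<omega>
    using m ut um by (simp add: Z_def)
  obtain k where k: "\<And>s. s \<in> F \<Longrightarrow> k s < m \<and> u (k s) = s"
    using idx unfolding G_def by (metis insertCI)
  have tele: "(\<Sum>i<j. Z i \<omega>) = B (u j) \<omega> - B 0 \<omega>" for j \<omega>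
    using sum_lessThan_telescope[of "\<lambda>i. B (u i) \<omega>" j] by (simp add: Z_def u0)
  have "indep_vars (\<lambda>_. borel) Z {..<m}"
    unfolding Z_def by (rule BM_indep_increments) (auto intro: nonneg mono)
  then have ind: "indep_var (PiM {..<m-1} (\<lambda>_. borel)) (\<lambda>\<omega>. restrict (\<lambda>i. Z i \<omega>) {..<m-1})
      (PiM {m-1} (\<lambda>_. borel)) (\<lambda>\<omega>. restrict (\<lambda>i. Z i \<omega>) {m-1})"
    using m by (intro indep_var_restrict) auto
  define E' where "E' = {z \<in> space (PiM {..<m-1} (\<lambda>_. borel :: real measure)). \<forall>s\<in>F. (\<Sum>i<k s. z i) \<in> A s}"
  define D' where "D' = {z \<in> space (PiM {m-1} (\<lambda>_. borel :: real measure)). z (m-1) \<in> D}"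
  have E': "E' \<in> sets (PiM {..<m-1} (\<lambda>_. borel))"
  proof -
    have "(\<lambda>z. \<Sum>i<k s. z i) \<in> borel_measurable (PiM {..<m-1} (\<lambda>_. borel :: real measure))" if "s \<in> F" for s
      using k[OF that] by (intro borel_measurable_sum measurable_component_singleton) auto
    then show ?thesis
      unfolding E'_def using F(1) A
      by (intro sets.sets_Collect_finite_All) (auto intro: measurable_sets_borel simp: measurable_sets Collect_conj_eq
          vimage_def[symmetric] Int_commute)
  qed
  have D': "D' \<in> sets (PiM {m-1} (\<lambda>_. borel))"
    unfolding D'_def using D by measurable
  let ?E = "{\<omega> \<in> space M. \<forall>s\<in>F. B s \<omega> \<in> A s}" and ?D = "{\<omega> \<in> space M. B (t + h) \<omega> - B t \<omega> \<in> D}"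
  let ?R = "\<lambda>\<omega>. restrict (\<lambda>i. Z i \<omega>) {..<m-1}" and ?Q = "\<lambda>\<omega>. restrict (\<lambda>i. Z i \<omega>) {m-1}"
  have [measurable]: "?E \<in> events"
  proof (rule sets.sets_Collect_finite_All)
    fix s assume "s \<in> F"
    then have [measurable]: "B s \<in> borel_measurable M" "A s \<in> sets borel"
      using F A by (auto intro!: BM_measurable)
    show "{\<omega> \<in> space M. B s \<omega> \<in> A s} \<in> events" by measurable
  qed (use F in auto)
  have [measurable]: "?D \<in> events"
  proof -
    have [measurable]: "B (t+h) \<in> borel_measurable M" "B t \<in> borel_measurable M" "D \<in> sets borel"
      using t D by (auto intro: BM_measurable)
    show ?thesis by measurable
  qed
  have D_eq: "?Q -` D' \<inter> space M = ?D"
    by (auto simp: D'_def space_PiM Zlast simp del: One_nat_def)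
  have RE: "?R -` E' \<inter> space M \<in> events"
    using ind E' by (auto simp: indep_var_eq intro: measurable_sets)
  have AE: "AE \<omega> in M. \<omega> \<in> ?E \<longleftrightarrow> \<omega> \<in> ?R -` E' \<inter> space M"
    using BM_start AE_space
  proof eventually_elim
    case (elim \<omega>)
    have "(\<Sum>i<k s. restrict (\<lambda>i. Z i \<omega>) {..<m-1} i) = B s \<omega>" if "s \<in> F" for s
    proof -
      have "(\<Sum>i<k s. restrict (\<lambda>i. Z i \<omega>) {..<m-1} i) = (\<Sum>i<k s. Z i \<omega>)"
        using k[OF that] by (intro sum.cong) auto
      then show ?thesis using k[OF that] elim by (simp add: tele)
    qed
    then show ?case using elim by (auto simp: E'_def space_PiM)
  qed
  have "prob (?E \<inter> ?D) = prob ((?R -` E' \<inter> space M) \<inter> ?D)"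
    using AE RE by (intro finite_measure_eq_AE) auto
  also have "\<dots> = prob ((\<lambda>\<omega>. (?R \<omega>, ?Q \<omega>)) -` (E' \<times> D') \<inter> space M)"
    by (rule arg_cong[where f=prob]) (use D_eq in blast)
  also have "\<dots> = prob (?R -` E' \<inter> space M) * prob ?D"
    using indep_varD[OF ind E' D'] D_eq by simp
  also have "prob (?R -` E' \<inter> space M) = prob ?E"
    using AE RE by (intro finite_measure_eq_AE) auto
  finally show ?thesis .
qed

end

context reflected_brownian_motion
begin

definition past :: "real \<Rightarrow> 'w set set" where
  "past t = sigma_sets (space M) (preimages M \<eta> \<union> (\<Union>s\<in>{0..t}. preimages M (B s)))"

lemma preimages_subset_events: "Y \<in> borel_measurable M \<Longrightarrow> preimages M Y \<subseteq> events"
  by (auto simp: preimages_def intro: measurable_sets)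

lemma Int_stable_preimages: "Int_stable (preimages M Y)"
proof (rule Int_stableI)
  fix E E' assume "E \<in> preimages M Y" "E' \<in> preimages M Y"
  then obtain A A' where "A \<in> sets borel" "A' \<in> sets borel"
      "E = Y -` A \<inter> space M" "E' = Y -` A' \<inter> space M"
    by (auto simp: preimages_def)
  then have "E \<inter> E' = Y -` (A \<inter> A') \<inter> space M" "A \<inter> A' \<in> sets borel" by auto
  then show "E \<inter> E' \<in> preimages M Y" unfolding preimages_def by blast
qed

lemma past_subset_events: "past t \<subseteq> events"
  unfolding past_def
  by (intro sets.sigma_sets_subset)
     (use preimages_subset_events[OF initial_measurable]
        subsetD[OF preimages_subset_events[OF BM_measurable]] in auto)

text \<open>The initial position splits off first, because it is independent of the whole Brownian motion.\<close>

lemma cylinder_indep_increment: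
  assumes F: "finite F" "F \<subseteq> {0..t}" and t: "0 \<le> t" "0 < h"
    and A: "A \<in> sets borel" and A': "\<And>s. s \<in> F \<Longrightarrow> A' s \<in> sets borel" and D: "D \<in> sets borel"
  shows "prob ({\<omega> \<in> space M. \<eta> \<omega> \<in> A \<and> (\<forall>s\<in>F. B s \<omega> \<in> A' s)}
      \<inter> {\<omega> \<in> space M. B (t + h) \<omega> - B t \<omega> \<in> D})
    = prob {\<omega> \<in> space M. \<eta> \<omega> \<in> A \<and> (\<forall>s\<in>F. B s \<omega> \<in> A' s)}
      * prob {\<omega> \<in> space M. B (t + h) \<omega> - B t \<omega> \<in> D}"
proof -
  let ?G = "\<Union>t\<in>{0..}. preimages M (B t)"
  define N where "N = sigma (space M) ?G"
  let ?I = "\<eta> -` A \<inter> space M" and ?E = "{\<omega> \<in> space M. \<forall>s\<in>F. B s \<omega> \<in> A' s}"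
    and ?D = "{\<omega> \<in> space M. B (t + h) \<omega> - B t \<omega> \<in> D}"
  have G: "?G \<subseteq> Pow (space M)" by (auto simp: preimages_def)
  have N: "space N = space M" "sets N = sigma_sets (space M) ?G"
    unfolding N_def using G by (auto simp: sets_measure_of)
  have B_N: "B s \<in> borel_measurable N" if "0 \<le> s" for s
  proof (rule measurableI)
    fix C :: "real set" assume "C \<in> sets borel"
    then have "B s -` C \<inter> space M \<in> ?G" using that by (auto simp: preimages_def)
    then show "B s -` C \<inter> space N \<in> sets N" using N by auto
  qed (use N in auto)
  have E: "?E \<in> sets N"
    unfolding N(1)[symmetric]
  proof (rule sets.sets_Collect_finite_All)
    fix s assume "s \<in> F"
    then have [measurable]: "B s \<in> borel_measurable N" "A' s \<in> sets borel"
      using F A' by (auto intro!: B_N)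
    show "{\<omega> \<in> space N. B s \<omega> \<in> A' s} \<in> sets N" by measurable
  qed (use F in auto)
  have D': "?D \<in> sets N"
  proof -
    have [measurable]: "B (t+h) \<in> borel_measurable N" "B t \<in> borel_measurable N" "D \<in> sets borel"
      using t D by (auto intro: B_N)
    show ?thesis unfolding N(1)[symmetric] by measurable
  qed
  have I: "?I \<in> preimages M \<eta>" using A by (auto simp: preimages_def)
  note ind = indep_setD[OF initial_indep I, folded N(2)]
  have eq: "{\<omega> \<in> space M. \<eta> \<omega> \<in> A \<and> (\<forall>s\<in>F. B s \<omega> \<in> A' s)} = ?I \<inter> ?E" by auto
  have "prob (?I \<inter> ?E \<inter> ?D) = prob ?I * prob (?E \<inter> ?D)"
    using ind[of "?E \<inter> ?D"] E D' by (simp add: Int_assoc)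
  also have "\<dots> = prob ?I * (prob ?E * prob ?D)"
    by (subst past_values_indep_increment[OF F t A' D]) auto
  also have "\<dots> = prob (?I \<inter> ?E) * prob ?D"
    using ind[OF E] by simp
  finally show ?thesis unfolding eq .
qed

text \<open>Cylinder events are stable under intersection and generate the past, so independence extends
  from them to the whole past.\<close>

lemma past_indep_increment:
  assumes t: "0 \<le> t" "0 < h"
  shows "indep_set (past t) (preimages M (\<lambda>\<omega>. B (t + h) \<omega> - B t \<omega>))"
proof -
  let ?Z = "\<lambda>\<omega>. B (t + h) \<omega> - B t \<omega>"
  define cyl where "cyl A F A' = {\<omega> \<in> space M. \<eta> \<omega> \<in> A \<and> (\<forall>s\<in>F. B s \<omega> \<in> A' s)}" for A F A'
  define C where "C = {cyl A F A' | A F A'. A \<in> sets borel \<and> finite F \<and> F \<subseteq> {0..t} \<and> (\<forall>s. A' s \<in> sets borel)}"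
  have C_I: "cyl A F A' \<in> C"
    if "A \<in> sets borel" "finite F" "F \<subseteq> {0..t}" "\<And>s. A' s \<in> sets borel" for A F A'
    using that unfolding C_def by blast
  have "past t = sigma_sets (space M) C"
  proof (rule antisym)
    show "past t \<subseteq> sigma_sets (space M) C"
      unfolding past_def
    proof (intro sigma_sets_mono', rule Un_least)
      show "preimages M \<eta> \<subseteq> C"
      proof
        fix E assume "E \<in> preimages M \<eta>"
        then obtain A where "A \<in> sets borel" "E = \<eta> -` A \<inter> space M" by (auto simp: preimages_def)
        then have "E = cyl A {} (\<lambda>_. UNIV)" by (auto simp: cyl_def)
        then show "E \<in> C" using C_I[of A "{}" "\<lambda>_. UNIV"] \<open>A \<in> sets borel\<close> by simp
      qed
      show "(\<Union>s\<in>{0..t}. preimages M (B s)) \<subseteq> C"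
      proof
        fix E assume "E \<in> (\<Union>s\<in>{0..t}. preimages M (B s))"
        then obtain A s where s: "A \<in> sets borel" "E = B s -` A \<inter> space M" "s \<in> {0..t}"
          by (auto simp: preimages_def)
        then have "E = cyl UNIV {s} (\<lambda>_. A)" by (auto simp: cyl_def)
        then show "E \<in> C" using C_I[of UNIV "{s}" "\<lambda>_. A"] s by simp
      qed
    qed
    have "C \<subseteq> past t"
    proof
      fix E assume "E \<in> C"
      then obtain A F A' where E: "E = cyl A F A'" "A \<in> sets borel" "finite F" "F \<subseteq> {0..t}"
        "\<And>s. A' s \<in> sets borel" by (auto simp: C_def)
      let ?G = "preimages M \<eta> \<union> (\<Union>s\<in>{0..t}. preimages M (B s))"
      interpret P: sigma_algebra "space M" "past t"
        unfolding past_def by (rule sigma_algebra_sigma_sets) (auto simp: preimages_def)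
      have gen: "E \<in> ?G \<Longrightarrow> E \<in> past t" for E by (auto simp: past_def)
      have "\<eta> -` A \<inter> space M \<in> past t" using E by (intro gen) (auto simp: preimages_def)
      moreover have "B s -` A' s \<inter> space M \<in> past t" if "s \<in> F" for s
        using E that by (intro gen UnI2 UN_I[of s]) (auto simp: preimages_def)
      then have "(\<Inter>s\<in>F. B s -` A' s \<inter> space M) \<inter> space M \<in> past t"
      proof (cases "F = {}")
        case False
        then have "(\<Inter>s\<in>F. B s -` A' s \<inter> space M) \<in> past t"
          using E(3) \<open>\<And>s. s \<in> F \<Longrightarrow> B s -` A' s \<inter> space M \<in> past t\<close> by (intro P.finite_INT)
        then show ?thesis using P.top by (rule P.Int)
      qed (use P.top in simp)
      ultimately have "(\<eta> -` A \<inter> space M) \<inter> ((\<Inter>s\<in>F. B s -` A' s \<inter> space M) \<inter> space M) \<in> past t"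
        by (rule P.Int)
      also have "(\<eta> -` A \<inter> space M) \<inter> ((\<Inter>s\<in>F. B s -` A' s \<inter> space M) \<inter> space M) = E"
        by (auto simp: E(1) cyl_def)
      finally show "E \<in> past t" .
    qed
    then have "sigma_sets (space M) C \<subseteq> sigma_sets (space M) (past t)" by (rule sigma_sets_mono')
    also have "sigma_sets (space M) (past t) = past t"
      unfolding past_def by (rule sigma_sets_sigma_sets_eq) (auto simp: preimages_def)
    finally show "sigma_sets (space M) C \<subseteq> past t" .
  qed
  moreover have "indep_set (sigma_sets (space M) C) (sigma_sets (space M) (preimages M ?Z))"
  proof (intro indep_set_sigma_sets Int_stable_preimages)
    have C_events: "C \<subseteq> events"
      using \<open>past t = sigma_sets (space M) C\<close> past_subset_events[of t] by auto
    have Z: "?Z \<in> borel_measurable M" using t by (auto intro!: borel_measurable_diff BM_measurable)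
    show "indep_set C (preimages M ?Z)"
    proof (intro indep_setI C_events preimages_subset_events Z)
      fix E D assume "E \<in> C" "D \<in> preimages M ?Z"
      then obtain A F A' D' where E: "E = cyl A F A'" "A \<in> sets borel" "finite F" "F \<subseteq> {0..t}"
        "\<And>s. A' s \<in> sets borel" and D: "D' \<in> sets borel" "D = ?Z -` D' \<inter> space M"
        by (auto simp: C_def preimages_def)
      have "D = {\<omega> \<in> space M. B (t + h) \<omega> - B t \<omega> \<in> D'}" using D by auto
      then show "prob (E \<inter> D) = prob E * prob D"
        unfolding E(1) cyl_def using E D t by (simp only:) (rule cylinder_indep_increment; simp)
    qed
    show "Int_stable C"
    proof (rule Int_stableI)
      fix E1 E2 assume "E1 \<in> C" "E2 \<in> C"
      then obtain A F A' G H G' where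
        1: "E1 = cyl A F A'" "A \<in> sets borel" "finite F" "F \<subseteq> {0..t}" "\<And>s. A' s \<in> sets borel" and
        2: "E2 = cyl H G G'" "H \<in> sets borel" "finite G" "G \<subseteq> {0..t}" "\<And>s. G' s \<in> sets borel"
        unfolding C_def by blast
      define K where "K s = (if s \<in> F then A' s else UNIV) \<inter> (if s \<in> G then G' s else UNIV)" for s
      have "E1 \<inter> E2 = cyl (A \<inter> H) (F \<union> G) K"
        unfolding 1 2 cyl_def K_def by auto
      moreover have "\<forall>s. K s \<in> sets borel" using 1 2 by (auto simp: K_def)
      moreover have "A \<inter> H \<in> sets borel" "finite (F \<union> G)" "F \<union> G \<subseteq> {0..t}" using 1 2 by auto
      ultimately show "E1 \<inter> E2 \<in> C" using C_I by metis
    qed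
  qed
  ultimately show ?thesis
    by (auto simp: indep_sets2_eq)
qed

lemma space_augmented_filtration [simp]: "space (augmented_filtration M \<eta> B t) = space M"
  by (simp add: augmented_filtration_def space_measure_of_conv)

lemma sets_augmented_filtration:
  "sets (augmented_filtration M \<eta> B t) = sigma_sets (space M)
     (preimages M \<eta> \<union> (\<Union>s\<in>{0..t}. preimages M (B s)) \<union> null_sets M)"
  unfolding augmented_filtration_def
  by (rule sets_measure_of) (use sets.sets_into_space in \<open>auto simp: preimages_def null_sets_def\<close>)

lemma augmented_filtration_subset_events: "sets (augmented_filtration M \<eta> B t) \<subseteq> events"
  unfolding sets_augmented_filtration
  by (intro sets.sigma_sets_subset)
     (use preimages_subset_events[OF initial_measurable]
        subsetD[OF preimages_subset_events[OF BM_measurable]] in \<open>auto simp: null_sets_def\<close>)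

text \<open>Null sets do not affect independence: up to one, the augmented filtration is the raw past.  This
  transfers independence to events of the filtration to which the process is adapted.\<close>

lemma augmented_filtration_eq_past_AE:
  assumes "E \<in> sets (augmented_filtration M \<eta> B t)"
  shows "\<exists>E'\<in>past t. AE \<omega> in M. \<omega> \<in> E \<longleftrightarrow> \<omega> \<in> E'"
  using assms unfolding sets_augmented_filtration
proof induction
  case (Basic E)
  then consider "E \<in> preimages M \<eta> \<union> (\<Union>s\<in>{0..t}. preimages M (B s))" | "E \<in> null_sets M" by blast
  then show ?case
  proof cases
    case 1
    then have "E \<in> past t" by (auto simp: past_def)
    then show ?thesis by (intro bexI[of _ E]) auto
  next
    case 2
    then show ?thesis
      by (intro bexI[of _ "{}"]) (auto simp: past_def sigma_sets.Empty dest: AE_not_in)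
  qed
next
  case Empty
  then show ?case by (intro bexI[of _ "{}"]) (auto simp: past_def sigma_sets.Empty)
next
  case (Compl E)
  then obtain E' where "E' \<in> past t" "AE \<omega> in M. \<omega> \<in> E \<longleftrightarrow> \<omega> \<in> E'" by blast
  moreover from this have "space M - E' \<in> past t" by (auto simp: past_def sigma_sets.Compl)
  ultimately show ?case by (intro bexI[of _ "space M - E'"]) auto
next
  case (Union E)
  then obtain E' where E': "\<And>i. E' i \<in> past t" "\<And>i::nat. AE \<omega> in M. \<omega> \<in> E i \<longleftrightarrow> \<omega> \<in> E' i" by metis
  then have "AE \<omega> in M. \<forall>i. \<omega> \<in> E i \<longleftrightarrow> \<omega> \<in> E' i" by (simp add: AE_all_countable)
  moreover have "(\<Union>i. E' i) \<in> past t" using E'(1) by (auto simp: past_def sigma_sets.Union)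
  ultimately show ?case by (intro bexI[of _ "\<Union>i. E' i"]) auto
qed

lemma adapted_measurable:
  "Z \<in> borel_measurable (augmented_filtration M \<eta> B t) \<Longrightarrow> Z \<in> borel_measurable M"
  using augmented_filtration_subset_events by (auto simp: measurable_def)

lemma adapted_indep_increment:
  fixes Z :: "'w \<Rightarrow> real"
  assumes t: "0 \<le> t" "0 < h" and Z: "Z \<in> borel_measurable (augmented_filtration M \<eta> B t)"
  shows "indep_var borel Z borel (\<lambda>\<omega>. B (t + h) \<omega> - B t \<omega>)"
proof -
  let ?D = "\<lambda>\<omega>. B (t + h) \<omega> - B t \<omega>"
  have D: "?D \<in> borel_measurable M" using t by (auto intro!: borel_measurable_diff BM_measurable)
  have "indep_set (preimages M Z) (preimages M ?D)"
  proof (intro indep_setI preimages_subset_events D adapted_measurable[OF Z])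
    fix E D assume E: "E \<in> preimages M Z" and D: "D \<in> preimages M ?D"
    have "E \<in> sets (augmented_filtration M \<eta> B t)"
      using E measurable_sets[OF Z] by (auto simp: preimages_def)
    then obtain E' where E': "E' \<in> past t" "AE \<omega> in M. \<omega> \<in> E \<longleftrightarrow> \<omega> \<in> E'" and "E \<in> events"
      using augmented_filtration_eq_past_AE augmented_filtration_subset_events by blast
    then have ev: "E \<in> events" "E' \<in> events" "D \<in> events"
      using past_subset_events D preimages_subset_events[OF \<open>?D \<in> borel_measurable M\<close>] by auto
    have "prob (E \<inter> D) = prob (E' \<inter> D)"
      using E' ev by (intro finite_measure_eq_AE) auto
    also have "\<dots> = prob E' * prob D"
      by (rule indep_setD[OF past_indep_increment[OF t] E'(1) D])
    also have "prob E' = prob E"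
      using E' ev by (intro finite_measure_eq_AE) auto
    finally show "prob (E \<inter> D) = prob E * prob D" .
  qed
  then have "indep_set (sigma_sets (space M) (preimages M Z)) (sigma_sets (space M) (preimages M ?D))"
    by (intro indep_set_sigma_sets Int_stable_preimages)
  then show ?thesis
    unfolding indep_var_eq preimages_def using D adapted_measurable[OF Z] by simp
qed

text \<open>The martingale property of \<open>exp (l B t - l\<^sup>2 t / 2)\<close>, tested against a bounded variable known at
  time \<open>t\<close>.\<close>

lemma expectation_times_exponential_increment:
  fixes Z :: "'w \<Rightarrow> real"
  assumes t: "0 \<le> t" "0 < h" and Z: "Z \<in> borel_measurable (augmented_filtration M \<eta> B t)"
    and bdd: "AE \<omega> in M. \<bar>Z \<omega>\<bar> \<le> C"
  shows "integrable M (\<lambda>\<omega>. Z \<omega> * exp (l * (B (t + h) \<omega> - B t \<omega>)))"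
    and "expectation (\<lambda>\<omega>. Z \<omega> * exp (l * (B (t + h) \<omega> - B t \<omega>))) = expectation Z * exp (l\<^sup>2 * h / 2)"
proof -
  have Z_int: "integrable M Z"
    using bdd adapted_measurable[OF Z] by (intro integrable_const_bound[of _ C]) auto
  have ind: "indep_var borel Z borel (\<lambda>\<omega>. exp (l * (B (t + h) \<omega> - B t \<omega>)))"
    using indep_var_compose[OF adapted_indep_increment[OF t Z], of "\<lambda>x. x" borel "\<lambda>x. exp (l * x)" borel]
    by (simp add: comp_def)
  note normal = increment_normal[OF t]
  have e_int: "integrable M (\<lambda>\<omega>. exp (l * (B (t + h) \<omega> - B t \<omega>)))"
    using t by (intro integrable_exp_normal[OF normal]) auto
  show "integrable M (\<lambda>\<omega>. Z \<omega> * exp (l * (B (t + h) \<omega> - B t \<omega>)))"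
    by (rule indep_var_integrable[OF ind Z_int e_int])
  show "expectation (\<lambda>\<omega>. Z \<omega> * exp (l * (B (t + h) \<omega> - B t \<omega>))) = expectation Z * exp (l\<^sup>2 * h / 2)"
    using indep_var_lebesgue_integral[OF ind Z_int e_int] expectation_exp_normal[OF normal, of l] t by simp
qed

end

section \<open>Estimates along a single path\<close>

text \<open>Sums are stopped by a predicate that, once false, stays false.  This replaces stopping times: only
  the value of the predicate at the current grid point has to be known.\<close>

lemma stopped_telescope:
  fixes P :: "nat \<Rightarrow> bool" and m :: "nat \<Rightarrow> real"
  assumes anti: "\<And>k. P (Suc k) \<Longrightarrow> P k"
  shows "\<exists>j\<le>n. (\<forall>k<n. P k \<longleftrightarrow> k < j) \<and>
    (\<Sum>k<n. if P k then m (Suc k) - m k else 0) = m j - m 0"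
proof (induction n)
  case (Suc n)
  then obtain j where j: "j \<le> n" "\<forall>k<n. P k \<longleftrightarrow> k < j"
    "(\<Sum>k<n. if P k then m (Suc k) - m k else 0) = m j - m 0" by blast
  have down: "P k" if "P n" "k \<le> n" for k
    using that(2,1) by (induction rule: inc_induct) (auto dest: anti)
  show ?case
  proof (cases "P n")
    case True
    then have "j = n" using j(1,2) down by (metis nat_less_le)
    then show ?thesis using j True down by (intro exI[of _ "Suc n"]) (auto simp: less_Suc_eq)
  next
    case False
    then show ?thesis using j by (intro exI[of _ j]) (auto simp: less_Suc_eq)
  qed
qed auto

text \<open>While the path is alive after the step as well, the terms are controlled by the increments of \<open>l\<close>,
  which telescope to at most \<open>K\<close>.  There is at most one further step, on which the path dies; it
  accounts for the 1.\<close>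

lemma stopped_correction_bound:
  fixes P Q :: "nat \<Rightarrow> bool" and l d :: "nat \<Rightarrow> real"
  assumes anti: "\<And>k. P (Suc k) \<Longrightarrow> P k"
    and l: "\<And>k. l k \<le> l (Suc k)" "0 \<le> l 0" "\<And>k. P k \<Longrightarrow> l k \<le> K" and K: "0 \<le> K" and c: "0 \<le> c"
    and inner: "\<And>k. k < n \<Longrightarrow> Q k \<Longrightarrow> P (Suc k) \<Longrightarrow> \<bar>d k\<bar> \<le> c * (l (Suc k) - l k)"
    and last: "\<And>k. k < n \<Longrightarrow> Q k \<Longrightarrow> P k \<Longrightarrow> \<bar>d k\<bar> \<le> c"
  shows "\<bar>\<Sum>k<n. if P k \<and> Q k then d k else 0\<bar> \<le> c * (K + 1)"
proof -
  have "\<bar>\<Sum>k<n. if P k \<and> Q k then d k else 0\<bar> \<le> (\<Sum>k<n. \<bar>if P k \<and> Q k then d k else 0\<bar>)"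
    by (rule sum_abs)
  also have "\<dots> \<le> (\<Sum>k<n. c * (if P (Suc k) then l (Suc k) - l k else 0)
      + c * (of_bool (P k) - of_bool (P (Suc k))))"
    using inner last anti l(1) c by (intro sum_mono) auto
  also have "\<dots> = c * (\<Sum>k<n. if P (Suc k) then l (Suc k) - l k else 0)
      + c * (\<Sum>k<n. of_bool (P k) - of_bool (P (Suc k)))"
    by (simp add: sum.distrib sum_distrib_left)
  also have "\<dots> \<le> c * K + c * 1"
  proof (intro add_mono mult_left_mono c)
    \<comment> \<open>The death step is counted by a telescoping sum.\<close>
    have "(\<Sum>k<n. of_bool (P k) - of_bool (P (Suc k))) = (of_bool (P 0) - of_bool (P n) :: real)"
      by (induction n) auto
    then show "(\<Sum>k<n. of_bool (P k) - of_bool (P (Suc k))) \<le> (1 :: real)" by simp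
    show "(\<Sum>k<n. if P (Suc k) then l (Suc k) - l k else 0) \<le> K"
    proof -
      obtain j where j: "j \<le> n" "\<forall>k<n. P (Suc k) \<longleftrightarrow> k < j"
        "(\<Sum>k<n. if P (Suc k) then l (Suc k) - l k else 0) = l j - l 0"
        using stopped_telescope[of "\<lambda>k. P (Suc k)" n l] anti by blast
      show ?thesis
      proof (cases j)
        case (Suc i)
        then have "l j \<le> K" using j(1,2) l(3) by auto
        then show ?thesis using j(3) l(2) by simp
      qed (use j(3) K in simp)
    qed
  qed
  finally show ?thesis using c by (simp add: algebra_simps)
qed

text \<open>The measure of the regulator gives the set where \<open>x = c\<close> the full mass \<open>l t\<close> of \<open>{0..t}\<close>, so an
  interval that avoids this set has mass zero.\<close>

lemma regulator_constant_off_level: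
  fixes x l :: "real \<Rightarrow> real"
  assumes x: "continuous_on {0..} x" and l: "continuous_on {0..} l" "mono_on {0..} l" "l 0 = 0"
    and reg: "\<And>t. 0 \<le> t \<Longrightarrow>
      (LINT s:{0..t}|interval_measure (\<lambda>r. l (max 0 r)). indicator {r. x r = c} s) = l t"
    and st: "0 \<le> s" "s \<le> t" and off: "\<And>r. r \<in> {s..t} \<Longrightarrow> x r \<noteq> c"
  shows "l t = l s"
proof -
  define F where "F = (\<lambda>r. l (max 0 r))"
  define N where "N = interval_measure F"
  define H where "H = {0..t} \<inter> {r. x r = c}"
  have F_mono: "F p \<le> F q" if "p \<le> q" for p q
    using that l(2) by (auto simp: F_def mono_on_def)
  have F_cont: "continuous_on UNIV F"
    unfolding F_def by (rule continuous_on_compose2[OF l(1)]) (auto intro!: continuous_intros)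
  have F_right: "continuous (at_right p) F" for p
    using F_cont by (meson UNIV_I continuous_on_eq_continuous_within continuous_within_subset subset_UNIV)
  have Icc: "emeasure N {0..t} = ennreal (l t)"
    using emeasure_interval_measure_Icc[OF _ F_mono F_cont, of 0 t] st l(3) by (simp add: N_def F_def)
  have Ioc: "measure N {s<..t} = l t - l s"
    using measure_interval_measure_Ioc[OF st(2) F_mono F_right] st by (simp add: N_def F_def)
  have lt: "0 \<le> l t" using mono_onD[OF l(2), of 0 t] l(3) st by simp
  have "closed H"
    using continuous_closed_preimage[OF continuous_on_subset[OF x], of "{0..t}" "{c}"]
    by (auto simp: H_def vimage_def)
  then have H: "H \<in> sets N" by (simp add: N_def)
  have "(LINT s:{0..t}|N. indicator {r. x r = c} s) = (\<integral>s. indicator H s \<partial>N)"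
    unfolding set_lebesgue_integral_def
    by (intro Bochner_Integration.integral_cong) (auto simp: H_def indicator_def)
  also have "\<dots> = measure N H" by (simp add: N_def)
  finally have H_eq: "measure N H = l t"
    using reg[of t] st by (simp add: N_def F_def)
  have fin: "emeasure N {0..t} \<noteq> \<infinity>" by (simp add: Icc)
  have "measure N (H \<union> {s<..t}) \<le> measure N {0..t}"
    using H st fin by (intro measure_mono_fmeasurable) (auto simp: H_def N_def fmeasurable_def less_top)
  also have "measure N (H \<union> {s<..t}) = measure N H + measure N {s<..t}"
  proof (rule measure_Union)
    have "H \<subseteq> {0..t}" "{s<..t} \<subseteq> {0..t}" using st by (auto simp: H_def)
    then show "emeasure N H \<noteq> \<infinity>" "emeasure N {s<..t} \<noteq> \<infinity>"
      using emeasure_mono[of H "{0..t}" N] emeasure_mono[of "{s<..t}" "{0..t}" N] fin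
      by (auto simp: N_def top_unique)
    have "z \<notin> {s<..t}" if "z \<in> H" for z using off[of z] that by (auto simp: H_def)
    then show "H \<inter> {s<..t} = {}" by blast
  qed (use H in \<open>auto simp: N_def\<close>)
  also have "measure N {0..t} = l t" using Icc lt by (simp add: measure_def)
  finally have "l t \<le> l s" using H_eq Ioc by simp
  then show ?thesis using l(2) st by (intro antisym) (auto simp: mono_on_def)
qed

text \<open>Since \<open>u'\<close> vanishes at \<open>a\<close>, it is at most proportional to the distance from \<open>a\<close>.  The increments
  of \<open>u\<close> near \<open>a\<close> are therefore of second order; the first-order bound serves away from \<open>a\<close>.\<close>

lemma neumann_increment_bounds:
  fixes u u' u'' :: "real \<Rightarrow> real"
  assumes u: "\<And>x. (u has_real_derivative u' x) (at x)" "\<And>x. (u' has_real_derivative u'' x) (at x)"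
    and u'': "continuous_on UNIV u''" and a: "u' a = 0" "a \<in> {p..q}"
  obtains C where "0 \<le> C"
    "\<And>x y. x \<in> {p..q} \<Longrightarrow> y \<in> {p..q} \<Longrightarrow> \<bar>u x - u y\<bar> \<le> C * \<bar>x - y\<bar>"
    "\<And>x y. x \<in> {p..q} \<Longrightarrow> y \<in> {p..q} \<Longrightarrow> \<bar>u x - u y\<bar> \<le> C * max \<bar>x - a\<bar> \<bar>y - a\<bar> * \<bar>x - y\<bar>"
proof -
  have "compact (u'' ` {p..q})"
    using u'' by (intro compact_continuous_image) (auto intro: continuous_on_subset)
  then obtain C where C: "\<And>x. x \<in> {p..q} \<Longrightarrow> \<bar>u'' x\<bar> \<le> C"
    by (meson bounded_real compact_imp_bounded imageI)
  have C0: "0 \<le> C" using C[OF a(2)] by linarith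
  have u'_bound: "\<bar>u' x\<bar> \<le> C * \<bar>x - a\<bar>" if "x \<in> {p..q}" for x
    using field_differentiable_bound[of "{p..q}" u' u'' C x a] that C a u(2)
    by (auto intro: has_field_derivative_at_within)
  have near: "\<bar>u x - u y\<bar> \<le> C * max \<bar>x - a\<bar> \<bar>y - a\<bar> * \<bar>x - y\<bar>"
    if "x \<in> {p..q}" "y \<in> {p..q}" for x y
  proof -
    have "\<bar>u' z\<bar> \<le> C * max \<bar>x - a\<bar> \<bar>y - a\<bar>" if z: "z \<in> {min x y..max x y}" for z
    proof -
      have "\<bar>u' z\<bar> \<le> C * \<bar>z - a\<bar>"
        using z \<open>x \<in> {p..q}\<close> \<open>y \<in> {p..q}\<close> by (intro u'_bound) auto
      also have "\<dots> \<le> C * max \<bar>x - a\<bar> \<bar>y - a\<bar>"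
        using z C0 by (intro mult_left_mono) auto
      finally show ?thesis .
    qed
    then show ?thesis
      using field_differentiable_bound[of "{min x y..max x y}" u u' "C * max \<bar>x - a\<bar> \<bar>y - a\<bar>" x y] u(1)
      by (auto intro: has_field_derivative_at_within)
  qed
  \<comment> \<open>The factor makes one constant serve both bounds.\<close>
  show thesis
  proof (rule that[of "C * max 1 (q - p)"])
    fix x y assume xy: "x \<in> {p..q}" "y \<in> {p..q}"
    have "C * max \<bar>x - a\<bar> \<bar>y - a\<bar> * \<bar>x - y\<bar> \<le> C * max 1 (q - p) * \<bar>x - y\<bar>"
      using xy a C0 by (intro mult_right_mono mult_left_mono) auto
    then show "\<bar>u x - u y\<bar> \<le> C * max 1 (q - p) * \<bar>x - y\<bar>" using near[OF xy] by linarith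
    have "C * max \<bar>x - a\<bar> \<bar>y - a\<bar> * \<bar>x - y\<bar>
        \<le> C * max 1 (q - p) * max \<bar>x - a\<bar> \<bar>y - a\<bar> * \<bar>x - y\<bar>"
      using C0 mult_left_mono[of 1 "max 1 (q - p)" C] by (intro mult_right_mono) auto
    then show "\<bar>u x - u y\<bar> \<le> C * max 1 (q - p) * max \<bar>x - a\<bar> \<bar>y - a\<bar> * \<bar>x - y\<bar>"
      using near[OF xy] by linarith
  qed (use C0 in auto)
qed

lemma uniform_grid_modulus:
  fixes x :: "real \<Rightarrow> real"
  assumes x: "continuous_on {0..} x" and T: "0 < T" and e: "0 < e"
  shows "\<forall>\<^sub>F n in sequentially. \<forall>k<n. \<forall>s\<in>{real k * (T / real n)..real (Suc k) * (T / real n)}.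
    \<bar>x s - x (real k * (T / real n))\<bar> \<le> e"
proof -
  have "uniformly_continuous_on {0..T} x"
    by (rule compact_uniformly_continuous) (auto intro: continuous_on_subset[OF x])
  then obtain d where d: "0 < d" "\<And>s t. s \<in> {0..T} \<Longrightarrow> t \<in> {0..T} \<Longrightarrow> dist t s < d \<Longrightarrow> dist (x t) (x s) < e"
    using e unfolding uniformly_continuous_on_def by metis
  have "(\<lambda>n. T / real n) \<longlonglongrightarrow> 0"
    by (rule lim_const_over_n)
  then have "\<forall>\<^sub>F n in sequentially. T / real n < d" using d(1) by (rule order_tendstoD)
  then show ?thesis
  proof eventually_elim
    case (elim n)
    show ?case
    proof (intro allI impI ballI)
      fix k s assume k: "k < n" and s: "s \<in> {real k * (T / real n)..real (Suc k) * (T / real n)}"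
      have "real (Suc k) * (T / real n) \<le> real n * (T / real n)"
        using k T by (intro mult_right_mono) auto
      then have "s \<le> T" using s k by auto
      moreover have "0 \<le> real k * (T / real n)" using T by simp
      moreover have "\<bar>s - real k * (T / real n)\<bar> < d" using s elim by (auto simp: algebra_simps add_divide_distrib)
      ultimately have "dist (x s) (x (real k * (T / real n))) < e"
        using s by (intro d(2)) (auto simp: dist_real_def)
      then show "\<bar>x s - x (real k * (T / real n))\<bar> \<le> e" by (simp add: dist_real_def)
    qed
  qed
qed

text \<open>What a single path of the reflected process needs to satisfy; \<open>y\<close> is the free motion
  \<open>\<eta> + \<mu> t + B t\<close>.  The last two assumptions are the pathwise form of the condition that the
  regulators increase only at the boundaries.\<close>

locale reflected_path =
  fixes x y l v :: "real \<Rightarrow> real" and a b :: real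
  assumes x_cont: "continuous_on {0..} x" and y_cont: "continuous_on {0..} y"
    and decomp: "\<And>t. 0 \<le> t \<Longrightarrow> x t = y t + l t - v t"
    and x_range: "\<And>t. 0 \<le> t \<Longrightarrow> x t \<in> {a..b}"
    and l_mono: "\<And>s t. 0 \<le> s \<Longrightarrow> s \<le> t \<Longrightarrow> l s \<le> l t" and l_0: "l 0 = 0"
    and l_flat: "\<And>s t. 0 \<le> s \<Longrightarrow> s \<le> t \<Longrightarrow> (\<And>r. r \<in> {s..t} \<Longrightarrow> x r \<noteq> a) \<Longrightarrow> l t = l s"
    and v_flat: "\<And>s t. 0 \<le> s \<Longrightarrow> s \<le> t \<Longrightarrow> (\<And>r. r \<in> {s..t} \<Longrightarrow> x r \<noteq> b) \<Longrightarrow> v t = v s"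
begin

text \<open>Below \<open>b\<close> the path deviates from the free motion by the increment of \<open>l\<close> only.  If this is not zero,
  then the path visits \<open>a\<close> during the step, so both arguments of \<open>u\<close> lie within \<open>2 w\<close> of \<open>a\<close>, where
  \<open>u\<close> is flat.\<close>

lemma correction_bound:
  assumes st: "0 \<le> s" "s \<le> t" and below: "\<And>r. r \<in> {s..t} \<Longrightarrow> x r < b"
    and y: "\<bar>y t - y s\<bar> \<le> w" and x: "\<And>r. r \<in> {s..t} \<Longrightarrow> \<bar>x r - x s\<bar> \<le> w"
    and C: "0 \<le> C" "\<And>z z'. z \<in> {p..q} \<Longrightarrow> z' \<in> {p..q} \<Longrightarrow>
      \<bar>u z - u z'\<bar> \<le> C * max \<bar>z - a\<bar> \<bar>z' - a\<bar> * \<bar>z - z'\<bar>"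
    and pq: "x t \<in> {p..q}" "x s + (y t - y s) \<in> {p..q}"
  shows "\<bar>u (x t) - u (x s + (y t - y s))\<bar> \<le> 2 * C * w * (l t - l s)"
proof -
  have "v t = v s" using st below by (intro v_flat) fastforce+
  then have diff: "x t - (x s + (y t - y s)) = l t - l s"
    using decomp[of s] decomp[of t] st by simp
  show ?thesis
  proof (cases "l t = l s")
    case True
    then have "x s + (y t - y s) = x t" using diff by simp
    then show ?thesis using True by simp
  next
    case False
    then obtain r where r: "r \<in> {s..t}" "x r = a" using l_flat[OF st] by metis
    have "\<bar>x t - a\<bar> \<le> 2 * w" using x[OF r(1)] x[of t] r(2) st by auto
    moreover have "\<bar>x s + (y t - y s) - a\<bar> \<le> 2 * w" using x[OF r(1)] r(2) y by auto
    ultimately have "C * max \<bar>x t - a\<bar> \<bar>x s + (y t - y s) - a\<bar> * \<bar>l t - l s\<bar> \<le> C * (2 * w) * \<bar>l t - l s\<bar>"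
      using C(1) by (intro mult_right_mono mult_left_mono) auto
    then show ?thesis
      using C(2)[OF pq] diff l_mono[OF st] by (simp add: mult_ac)
  qed
qed

end

section \<open>Exponential moments of large increments\<close>

text \<open>This is \<open>(exp (c x / 2) - exp (- c x / 2))\<^sup>4\<close>, expanded.  It dominates \<open>exp (c \<bar>x\<bar>)\<close> away from 0 and is of
  fourth order at 0, so its mean for a normal variable of variance \<open>h\<close> is of order \<open>h\<^sup>2\<close>; moreover,
  this mean is an explicit combination of exponentials.\<close>

definition exp_quartic :: "real \<Rightarrow> real \<Rightarrow> real" where
  "exp_quartic c x = exp (2 * c * x) + exp (- 2 * c * x) - 4 * exp (c * x) - 4 * exp (- c * x) + 6"

lemma exp_quartic_eq: "exp_quartic c x = exp (2 * (c * x)) * (1 - exp (- (c * x))) ^ 4"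
proof -
  have 1: "exp (2 * c * x) = exp (c * x) * exp (c * x)" "exp (2 * (c * x)) = exp (c * x) * exp (c * x)"
    "exp (- 2 * c * x) = exp (- (c * x)) * exp (- (c * x))"
    by (simp_all add: exp_add[symmetric])
  have 2: "exp (c * x) * exp (- (c * x)) = 1" by (simp add: exp_add[symmetric])
  have 3: "exp (- c * x) = exp (- (c * x))" by simp
  show ?thesis unfolding exp_quartic_def 1 3 using 2 by algebra
qed

lemma exp_quartic_nonneg: "0 \<le> exp_quartic c x"
  by (simp add: exp_quartic_eq)

lemma exp_abs_le_quartic:
  assumes c: "0 < c" and x: "1 \<le> \<bar>x\<bar>"
  shows "exp (c * \<bar>x\<bar>) \<le> exp_quartic c x / (1 - exp (- c)) ^ 4"
proof -
  have y: "c \<le> c * \<bar>x\<bar>" using c x by (simp add: mult_le_cancel_left1)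
  have "exp (c * \<bar>x\<bar>) * (1 - exp (- c)) ^ 4 \<le> exp (2 * (c * \<bar>x\<bar>)) * (1 - exp (- (c * \<bar>x\<bar>))) ^ 4"
    using y c by (intro mult_mono power_mono) auto
  also have "\<dots> = exp_quartic c x"
    unfolding exp_quartic_eq[symmetric] by (cases "0 \<le> x") (auto simp: exp_quartic_def)
  finally show ?thesis
    using c by (simp add: field_simps)
qed

lemma (in prob_space) exp_quartic_normal:
  fixes Z :: "'a \<Rightarrow> real" and c \<sigma> :: real
  assumes Z: "distributed M lborel Z (normal_density 0 \<sigma>)" and \<sigma>: "0 < \<sigma>"
  shows integrable_exp_quartic_normal: "integrable M (\<lambda>\<omega>. exp_quartic c (Z \<omega>))"
    and expectation_exp_quartic_normal: "expectation (\<lambda>\<omega>. exp_quartic c (Z \<omega>))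
      = 2 * exp (2 * c\<^sup>2 * \<sigma>\<^sup>2) - 8 * exp (c\<^sup>2 * \<sigma>\<^sup>2 / 2) + 6"
proof -
  note i = integrable_exp_normal[OF Z \<sigma>] and e = expectation_exp_normal[OF Z \<sigma>]
  show "integrable M (\<lambda>\<omega>. exp_quartic c (Z \<omega>))"
    unfolding exp_quartic_def by (intro Bochner_Integration.integrable_add Bochner_Integration.integrable_diff
        integrable_mult_right i integrable_const)
  have "expectation (\<lambda>\<omega>. exp_quartic c (Z \<omega>)) = expectation (\<lambda>\<omega>. exp (2 * c * Z \<omega>))
      + expectation (\<lambda>\<omega>. exp (- 2 * c * Z \<omega>)) - 4 * expectation (\<lambda>\<omega>. exp (c * Z \<omega>))
      - 4 * expectation (\<lambda>\<omega>. exp (- c * Z \<omega>)) + 6"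
    unfolding exp_quartic_def
    using i[of "2 * c"] i[of "- 2 * c"] i[of c] i[of "- c"] by (simp add: prob_space)
  also have "\<dots> = 2 * exp (2 * c\<^sup>2 * \<sigma>\<^sup>2) - 8 * exp (c\<^sup>2 * \<sigma>\<^sup>2 / 2) + 6"
    unfolding e by (simp add: power2_eq_square)
  finally show "expectation (\<lambda>\<omega>. exp_quartic c (Z \<omega>))
      = 2 * exp (2 * c\<^sup>2 * \<sigma>\<^sup>2) - 8 * exp (c\<^sup>2 * \<sigma>\<^sup>2 / 2) + 6" .
qed

text \<open>The sum over \<open>n\<close> steps of variance of order \<open>1 / n\<close>.\<close>

lemma exp_quartic_mean_limit:
  fixes \<beta> :: real
  shows "(\<lambda>n. real n * (2 * exp (2 * \<beta> / real n) - 8 * exp (\<beta> / real n / 2) + 6)) \<longlonglongrightarrow> 0"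
  by real_asymp

section \<open>The first passage of the reflected process\<close>

text \<open>The infimum in the definition of the passage time runs over a closed set, hence is attained; before
  it the path is below \<open>S\<close> by the intermediate value theorem.\<close>

lemma first_passage_time_continuous_path:
  assumes cont: "continuous_on {0..} (\<lambda>t. X t \<omega>)" and start: "X 0 \<omega> < S"
    and fin: "first_passage_time X S \<omega> < \<infinity>"
  obtains m where "first_passage_time X S \<omega> = ereal m" "0 < m" "X m \<omega> = S"
    "\<And>s. 0 \<le> s \<Longrightarrow> s < m \<Longrightarrow> X s \<omega> < S"
proof -
  define Z where "Z = {t. 0 < t \<and> X t \<omega> = S}"
  define m where "m = Inf Z"
  have Z_eq: "Z = {0..} \<inter> (\<lambda>t. X t \<omega>) -` {S}"
    using start by (auto simp: Z_def less_le)
  have "closed Z"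
    unfolding Z_eq by (rule continuous_closed_preimage[OF cont]) auto
  moreover have ne: "Z \<noteq> {}"
  proof
    assume "Z = {}"
    then show False using fin unfolding first_passage_time_def Z_def[symmetric] by (simp add: top_ereal_def)
  qed
  moreover have bdd: "bdd_below Z" by (rule bdd_belowI[of _ 0]) (auto simp: Z_def)
  ultimately have mZ: "m \<in> Z" unfolding m_def by (intro closed_contains_Inf)
  have m_le: "m \<le> z" if "z \<in> Z" for z unfolding m_def using that bdd by (rule cInf_lower)
  show thesis
  proof
    show "first_passage_time X S \<omega> = ereal m"
      unfolding first_passage_time_def Z_def[symmetric]
      by (intro antisym INF_lower[OF mZ] INF_greatest) (use m_le in auto)
    show "0 < m" "X m \<omega> = S" using mZ by (auto simp: Z_def)
    fix s assume s: "0 \<le> s" "s < m"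
    show "X s \<omega> < S"
    proof (rule ccontr)
      assume "\<not> X s \<omega> < S"
      then obtain r where r: "0 \<le> r" "r \<le> s" "X r \<omega> = S"
        using IVT'[of "\<lambda>t. X t \<omega>" 0 S s] start s continuous_on_subset[OF cont, of "{0..s}"] by auto
      then have "r \<in> Z" using start by (auto simp: Z_def less_le)
      then show False using m_le r s by force
    qed
  qed
qed

context reflected_brownian_motion
begin

lemma AE_reflected_path:
  "AE \<omega> in M. reflected_path (\<lambda>t. X t \<omega>) (\<lambda>t. \<eta> \<omega> + \<mu> * t + B t \<omega>) (\<lambda>t. L t \<omega>) (\<lambda>t. U t \<omega>) a b"
  using BM_continuous sde range regulators_start regulators_continuous regulators_mono
    lower_regulator upper_regulator
proof eventually_elim
  case (elim \<omega>)
  have "continuous_on {0..} (\<lambda>t. \<eta> \<omega> + \<mu> * t + B t \<omega> + L t \<omega> - U t \<omega>)"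
    using elim(1,5) by (intro continuous_intros) auto
  then have cont: "continuous_on {0..} (\<lambda>t. X t \<omega>)"
    by (rule continuous_on_eq) (use elim(2) in auto)
  show ?case
  proof
    show "continuous_on {0..} (\<lambda>t. X t \<omega>)" by (fact cont)
    show "continuous_on {0..} (\<lambda>t. \<eta> \<omega> + \<mu> * t + B t \<omega>)"
      using elim(1) by (intro continuous_intros) auto
    fix s t :: real assume "0 \<le> s" "s \<le> t"
    then show "L s \<omega> \<le> L t \<omega>" using elim(6) by (auto intro: mono_onD)
    show "L t \<omega> = L s \<omega>" if "\<And>r. r \<in> {s..t} \<Longrightarrow> X r \<omega> \<noteq> a"
      by (rule regulator_constant_off_level[OF cont conjunct1[OF elim(5)] conjunct1[OF elim(6)]
          conjunct1[OF elim(4)] elim(7)[rule_format] \<open>0 \<le> s\<close> \<open>s \<le> t\<close> that])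
    show "U t \<omega> = U s \<omega>" if "\<And>r. r \<in> {s..t} \<Longrightarrow> X r \<omega> \<noteq> b"
      by (rule regulator_constant_off_level[OF cont conjunct2[OF elim(5)] conjunct2[OF elim(6)]
          conjunct2[OF elim(4)] elim(8)[rule_format] \<open>0 \<le> s\<close> \<open>s \<le> t\<close> that])
  qed (use elim(2-4) in auto)
qed

lemma augmented_filtration_mono:
  assumes "s \<le> t"
  shows "sets (augmented_filtration M \<eta> B s) \<subseteq> sets (augmented_filtration M \<eta> B t)"
  unfolding sets_augmented_filtration using assms by (intro sigma_sets_mono') auto

lemma X_measurable_filtration:
  assumes "0 \<le> s" "s \<le> t"
  shows "X s \<in> borel_measurable (augmented_filtration M \<eta> B t)"
  using adapted(1)[OF assms(1)] augmented_filtration_mono[OF assms(2)] by (auto simp: measurable_def)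

lemma X_measurable: "0 \<le> t \<Longrightarrow> X t \<in> borel_measurable M"
  and L_measurable: "0 \<le> t \<Longrightarrow> L t \<in> borel_measurable M"
  using adapted adapted_measurable by blast+

end

locale passage_from_below = reflected_brownian_motion +
  fixes S :: real
  assumes level_le: "S \<le> b"
    and start_below: "AE \<omega> in M. X 0 \<omega> < S"
    and passage_measurable: "first_passage_time X S \<in> borel_measurable M"
    and passage_finite: "AE \<omega> in M. first_passage_time X S \<omega> < \<infinity>"
begin

definition passage :: "'a \<Rightarrow> real" where
  "passage \<omega> = real_of_ereal (first_passage_time X S \<omega>)"

lemma passage_random_variable [measurable]: "passage \<in> borel_measurable M"
  unfolding passage_def[abs_def] using passage_measurable by simp

text \<open>Up to a null set, the event that at time \<open>t\<close> the level has not yet been reached and that \<open>L t \<le> K\<close>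
  (lemma \<open>alive_iff\<close>).  Staying away from \<open>S\<close> at the countably many rational times up to \<open>t\<close>, with
  a positive margin, makes it an event of the filtration at time \<open>t\<close>.\<close>

definition alive :: "real \<Rightarrow> real \<Rightarrow> 'a set" where
  "alive K t = {\<omega> \<in> space M. (\<exists>m::nat. \<forall>s\<in>\<rat> \<inter> {0..t}. X s \<omega> \<le> S - 1 / real (Suc m)) \<and> L t \<omega> \<le> K}"

lemma alive_measurable:
  assumes t: "0 \<le> t"
  shows "alive K t \<in> sets (augmented_filtration M \<eta> B t)"
proof -
  let ?F = "augmented_filtration M \<eta> B t"
  have [measurable]: "L t \<in> borel_measurable ?F" using adapted t by simp
  have "{\<omega> \<in> space ?F. (\<exists>m::nat. \<forall>s\<in>\<rat> \<inter> {0..t}. X s \<omega> \<le> S - 1 / real (Suc m))} \<in> sets ?F"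
  proof (intro sets.sets_Collect_countable_Ex sets.sets_Collect_countable_All')
    show "countable (\<rat> \<inter> {0..t})" using countable_rat by blast
    show "{\<omega> \<in> space ?F. X s \<omega> \<le> S - 1 / real (Suc m)} \<in> sets ?F" if "s \<in> \<rat> \<inter> {0..t}" for m s
    proof -
      have [measurable]: "X s \<in> borel_measurable ?F" using that by (auto intro: X_measurable_filtration)
      show ?thesis by measurable
    qed
  qed
  moreover have "{\<omega> \<in> space ?F. L t \<omega> \<le> K} \<in> sets ?F" by measurable
  ultimately have "{\<omega> \<in> space ?F. (\<exists>m::nat. \<forall>s\<in>\<rat> \<inter> {0..t}. X s \<omega> \<le> S - 1 / real (Suc m)) \<and> L t \<omega> \<le> K}
      \<in> sets ?F" by - (rule sets.sets_Collect_conj; assumption)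
  then show ?thesis by (simp add: alive_def)
qed

text \<open>Holds for almost every path (lemma \<open>AE_typical\<close>); with it, the estimates for single paths apply and
  the almost sure properties of the process need not be combined again each time.\<close>

definition typical :: "'a \<Rightarrow> bool" where
  "typical \<omega> \<longleftrightarrow> reflected_path (\<lambda>t. X t \<omega>) (\<lambda>t. \<eta> \<omega> + \<mu> * t + B t \<omega>) (\<lambda>t. L t \<omega>) (\<lambda>t. U t \<omega>) a b
    \<and> 0 < passage \<omega> \<and> X (passage \<omega>) \<omega> = S \<and> (\<forall>s. 0 \<le> s \<longrightarrow> s < passage \<omega> \<longrightarrow> X s \<omega> < S)"

lemma AE_typical: "AE \<omega> in M. typical \<omega>"
  using AE_reflected_path start_below passage_finite
proof eventually_elim
  case (elim \<omega>)
  then interpret reflected_path "\<lambda>t. X t \<omega>" "\<lambda>t. \<eta> \<omega> + \<mu> * t + B t \<omega>" "\<lambda>t. L t \<omega>" "\<lambda>t. U t \<omega>" a b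
    by simp
  show ?case
  proof (rule first_passage_time_continuous_path[of X \<omega> S, OF x_cont elim(2,3)])
    fix m assume "first_passage_time X S \<omega> = ereal m" and m: "0 < m" "X m \<omega> = S"
      "\<And>s. 0 \<le> s \<Longrightarrow> s < m \<Longrightarrow> X s \<omega> < S"
    then have "passage \<omega> = m" by (simp add: passage_def)
    then show "typical \<omega>" unfolding typical_def using elim(1) m by blast
  qed
qed

text \<open>On a compact time interval a continuous path below \<open>S\<close> has a positive distance from \<open>S\<close>, and this is
  witnessed by the margins \<open>1 / (m + 1)\<close>.\<close>

lemma alive_iff:
  assumes typical: "typical \<omega>" and \<omega>: "\<omega> \<in> space M" and t: "0 \<le> t"
  shows "\<omega> \<in> alive K t \<longleftrightarrow> t < passage \<omega> \<and> L t \<omega> \<le> K"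
proof -
  interpret reflected_path "\<lambda>t. X t \<omega>" "\<lambda>t. \<eta> \<omega> + \<mu> * t + B t \<omega>" "\<lambda>t. L t \<omega>" "\<lambda>t. U t \<omega>" a b
    using typical by (simp add: typical_def)
  have "(\<exists>m::nat. \<forall>s\<in>\<rat> \<inter> {0..t}. X s \<omega> \<le> S - 1 / real (Suc m)) \<longleftrightarrow> t < passage \<omega>"
  proof
    assume "\<exists>m::nat. \<forall>s\<in>\<rat> \<inter> {0..t}. X s \<omega> \<le> S - 1 / real (Suc m)"
    then obtain m :: nat where m: "\<forall>s\<in>\<rat> \<inter> {0..t}. X s \<omega> \<le> S - 1 / real (Suc m)"
      by blast
    show "t < passage \<omega>"
    proof (rule ccontr)
      assume not: "\<not> t < passage \<omega>"
      have p: "0 < passage \<omega>" "X (passage \<omega>) \<omega> = S" using typical by (auto simp: typical_def)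
      obtain d where d: "0 < d" "\<And>s. 0 \<le> s \<Longrightarrow> dist s (passage \<omega>) < d \<Longrightarrow>
          dist (X s \<omega>) (X (passage \<omega>) \<omega>) < 1 / real (Suc m)"
        using x_cont[unfolded continuous_on_iff, rule_format, of "passage \<omega>" "1 / real (Suc m)"] p
        by (auto simp del: of_nat_Suc)
      obtain s where s: "s \<in> \<rat>" "max 0 (passage \<omega> - d) < s" "s < passage \<omega>"
        using Rats_dense_in_real[of "max 0 (passage \<omega> - d)" "passage \<omega>"] p d(1) by auto
      have "dist (X s \<omega>) S < 1 / real (Suc m)" using d(2)[of s] s p by (auto simp: dist_real_def)
      moreover have "X s \<omega> \<le> S - 1 / real (Suc m)" using s not by (intro bspec[OF m]) auto
      ultimately show False by (simp add: dist_real_def)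
    qed
  next
    assume lt: "t < passage \<omega>"
    have "continuous_on {0..t} (\<lambda>s. X s \<omega>)" by (rule continuous_on_subset[OF x_cont]) auto
    then obtain r where r: "r \<in> {0..t}" "\<And>s. s \<in> {0..t} \<Longrightarrow> X s \<omega> \<le> X r \<omega>"
      using continuous_attains_sup[of "{0..t}" "\<lambda>s. X s \<omega>"] t by auto
    have "X r \<omega> < S" using typical r lt by (auto simp: typical_def)
    then obtain m :: nat where "inverse (real (Suc m)) < S - X r \<omega>"
      using reals_Archimedean[of "S - X r \<omega>"] by auto
    then have "\<forall>s\<in>\<rat> \<inter> {0..t}. X s \<omega> \<le> S - 1 / real (Suc m)"
      using r(2) by (force simp: inverse_eq_divide simp del: of_nat_Suc)
    then show "\<exists>m::nat. \<forall>s\<in>\<rat> \<inter> {0..t}. X s \<omega> \<le> S - 1 / real (Suc m)" by blast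
  qed
  then show ?thesis using \<omega> by (auto simp: alive_def simp del: of_nat_Suc)
qed

end

section \<open>Corrections due to reflection\<close>

text \<open>The roots are the exponents for which \<open>exp (l x)\<close> satisfies \<open>u'' / 2 + \<mu> u' = \<theta> u\<close>; the last
  assumption is \<open>u'(a) = 0\<close>.\<close>

locale neumann_eigenfunction = passage_from_below +
  fixes \<theta> c\<^sub>1 l\<^sub>1 c\<^sub>2 l\<^sub>2 :: real and u :: "real \<Rightarrow> real"
  defines "u \<equiv> \<lambda>x. c\<^sub>1 * exp (l\<^sub>1 * x) + c\<^sub>2 * exp (l\<^sub>2 * x)"
  assumes rate_nonneg: "0 \<le> \<theta>"
    and root\<^sub>1: "l\<^sub>1\<^sup>2 / 2 + \<mu> * l\<^sub>1 = \<theta>" and root\<^sub>2: "l\<^sub>2\<^sup>2 / 2 + \<mu> * l\<^sub>2 = \<theta>"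
    and neumann: "c\<^sub>1 * l\<^sub>1 * exp (l\<^sub>1 * a) + c\<^sub>2 * l\<^sub>2 * exp (l\<^sub>2 * a) = 0"
begin

text \<open>The part of the discounted increment of \<open>u (X t)\<close> over a step of length \<open>h\<close> that is due to the
  regulators: the difference between the reflected step and the free step from the same position.\<close>

definition correction :: "real \<Rightarrow> real \<Rightarrow> 'a \<Rightarrow> real" where
  "correction h t \<omega> = exp (- \<theta> * (t + h)) *
     (u (X (t + h) \<omega>) - u (X t \<omega> + \<mu> * h + (B (t + h) \<omega> - B t \<omega>)))"

lemma u_borel [measurable]: "u \<in> borel_measurable borel"
  unfolding u_def by measurable

lemma a_le_b: "a \<le> b"
proof -
  have "AE \<omega> in M. a \<le> b"
    using range by eventually_elim (auto dest: spec[of _ 0])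
  then show ?thesis by simp
qed

lemma AE_range: "0 \<le> t \<Longrightarrow> AE \<omega> in M. X t \<omega> \<in> {a..b}"
  using range by (auto elim: eventually_mono)

lemma exp_X_bounded:
  assumes t: "0 \<le> t"
  shows "AE \<omega> in M. \<bar>exp (l * X t \<omega>)\<bar> \<le> exp (\<bar>l\<bar> * max \<bar>a\<bar> \<bar>b\<bar>)"
  using AE_range[OF t]
proof eventually_elim
  case (elim \<omega>)
  have "l * X t \<omega> \<le> \<bar>l * X t \<omega>\<bar>" by simp
  also have "\<dots> \<le> \<bar>l\<bar> * max \<bar>a\<bar> \<bar>b\<bar>"
    unfolding abs_mult using elim by (intro mult_left_mono) auto
  finally show ?case by simp
qed

lemma u_bounded: obtains C where "0 \<le> C" "\<And>x. x \<in> {a..b} \<Longrightarrow> \<bar>u x\<bar> \<le> C"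
proof -
  have "compact (u ` {a..b})"
    unfolding u_def by (intro compact_continuous_image continuous_intros) auto
  then obtain C where C: "\<And>x. x \<in> {a..b} \<Longrightarrow> \<bar>u x\<bar> \<le> C"
    by (meson bounded_real compact_imp_bounded imageI)
  show thesis by (rule that[of "\<bar>C\<bar>"]) (use C in force)+
qed

lemma integrable_u_X:
  assumes t: "0 \<le> t"
  shows "integrable M (\<lambda>\<omega>. u (X t \<omega>))"
proof -
  have [measurable]: "X t \<in> borel_measurable M" by (rule X_measurable[OF t])
  obtain C where C: "\<And>x. x \<in> {a..b} \<Longrightarrow> \<bar>u x\<bar> \<le> C" using u_bounded by blast
  show ?thesis
  proof (rule integrable_const_bound[of _ C])
    show "AE \<omega> in M. norm (u (X t \<omega>)) \<le> C" using AE_range[OF t] by eventually_elim (simp add: C)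
  qed measurable
qed

text \<open>Over a free step \<open>exp (- \<theta> t) u\<close> is exactly preserved in mean, by the equation for the exponents and
  because \<open>A\<close> and \<open>X t\<close> are determined by the past, which is independent of the next increment.\<close>

lemma one_step:
  assumes t: "0 \<le> t" and h: "0 < h" and A: "A \<in> sets (augmented_filtration M \<eta> B t)"
  shows "integrable M (\<lambda>\<omega>. indicator A \<omega> * (exp (- \<theta> * (t + h)) * u (X (t + h) \<omega>) - exp (- \<theta> * t) * u (X t \<omega>)))"
    and "integrable M (\<lambda>\<omega>. indicator A \<omega> * correction h t \<omega>)"
    and "expectation (\<lambda>\<omega>. indicator A \<omega> * (exp (- \<theta> * (t + h)) * u (X (t + h) \<omega>) - exp (- \<theta> * t) * u (X t \<omega>)))
      = expectation (\<lambda>\<omega>. indicator A \<omega> * correction h t \<omega>)"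
proof -
  let ?D = "\<lambda>\<omega>. B (t + h) \<omega> - B t \<omega>" and ?N = "\<lambda>t \<omega>. exp (- \<theta> * t) * u (X t \<omega>)"
  have A_ev: "A \<in> events" using A augmented_filtration_subset_events by blast
  define Z where "Z = (\<lambda>l \<omega>. indicator A \<omega> * exp (l * X t \<omega>))"
  have Z_adapted: "Z l \<in> borel_measurable (augmented_filtration M \<eta> B t)" for l
  proof -
    have [measurable]: "X t \<in> borel_measurable (augmented_filtration M \<eta> B t)"
      "A \<in> sets (augmented_filtration M \<eta> B t)" using adapted t A by auto
    show ?thesis unfolding Z_def by measurable
  qed
  have Z_bdd: "AE \<omega> in M. \<bar>Z l \<omega>\<bar> \<le> exp (\<bar>l\<bar> * max \<bar>a\<bar> \<bar>b\<bar>)" for l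
    using exp_X_bounded[OF t, of l] by eventually_elim (auto simp: Z_def indicator_def)
  note mart = expectation_times_exponential_increment[OF t h Z_adapted Z_bdd]
  have Z_int: "integrable M (Z l)" for l
    using mart(1)[of l 0] by simp
  \<comment> \<open>The martingale increment of the free step for a single exponential.\<close>
  define W where "W = (\<lambda>l \<omega>. exp (- \<theta> * (t + h) + l * \<mu> * h) * (Z l \<omega> * exp (l * ?D \<omega>)) - exp (- \<theta> * t) * Z l \<omega>)"
  have W_int: "integrable M (W l)" for l
    unfolding W_def using mart(1) Z_int by (intro Bochner_Integration.integrable_diff integrable_mult_right) auto
  have W_mean: "expectation (W l) = 0" if "l\<^sup>2 / 2 + \<mu> * l = \<theta>" for l
  proof -
    have "expectation (W l) = exp (- \<theta> * (t + h) + l * \<mu> * h) * (expectation (Z l) * exp (l\<^sup>2 * h / 2))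
        - exp (- \<theta> * t) * expectation (Z l)"
      unfolding W_def using mart Z_int by simp
    also have "exp (- \<theta> * (t + h) + l * \<mu> * h) * (expectation (Z l) * exp (l\<^sup>2 * h / 2))
        = exp (- \<theta> * (t + h) + l * \<mu> * h + l\<^sup>2 * h / 2) * expectation (Z l)"
      by (simp add: exp_add)
    also have "- \<theta> * (t + h) + l * \<mu> * h + l\<^sup>2 * h / 2 = - \<theta> * t"
      unfolding that[symmetric] by (simp add: field_simps)
    finally show ?thesis by simp
  qed
  have eq: "indicator A \<omega> * (?N (t + h) \<omega> - ?N t \<omega>)
      = indicator A \<omega> * correction h t \<omega> + (c\<^sub>1 * W l\<^sub>1 \<omega> + c\<^sub>2 * W l\<^sub>2 \<omega>)" for \<omega>
  proof -
    have shift: "exp (- \<theta> * (t + h) + l * \<mu> * h) * (exp (l * X t \<omega>) * exp (l * ?D \<omega>))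
        = exp (- \<theta> * (t + h)) * exp (l * (X t \<omega> + \<mu> * h + ?D \<omega>))" for l
      by (simp add: exp_add[symmetric] algebra_simps)
    show ?thesis
    proof (cases "\<omega> \<in> A")
      case True
      have "W l \<omega> = exp (- \<theta> * (t + h)) * exp (l * (X t \<omega> + \<mu> * h + ?D \<omega>)) - exp (- \<theta> * t) * exp (l * X t \<omega>)" for l
        by (simp only: W_def Z_def indicator_simps(1)[OF True] mult_1_left shift)
      then show ?thesis
        unfolding correction_def u_def using True by (simp only: indicator_simps) (simp add: algebra_simps)
    qed (simp add: W_def Z_def)
  qed
  have [measurable]: "X t \<in> borel_measurable M" "X (t + h) \<in> borel_measurable M"
    using t h by (auto intro!: X_measurable)
  have "integrable M (\<lambda>\<omega>. (?N (t + h) \<omega> - ?N t \<omega>) * indicator A \<omega>)"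
    using t h A_ev integrable_u_X
    by (intro integrable_real_mult_indicator Bochner_Integration.integrable_diff integrable_mult_right) auto
  then show 1: "integrable M (\<lambda>\<omega>. indicator A \<omega> * (?N (t + h) \<omega> - ?N t \<omega>))"
    by (simp add: mult.commute)
  have "integrable M (\<lambda>\<omega>. indicator A \<omega> * (?N (t + h) \<omega> - ?N t \<omega>) - (c\<^sub>1 * W l\<^sub>1 \<omega> + c\<^sub>2 * W l\<^sub>2 \<omega>))"
    using 1 W_int by (intro Bochner_Integration.integrable_diff Bochner_Integration.integrable_add integrable_mult_right)
  then show 2: "integrable M (\<lambda>\<omega>. indicator A \<omega> * correction h t \<omega>)"
    unfolding eq by simp
  show "expectation (\<lambda>\<omega>. indicator A \<omega> * (?N (t + h) \<omega> - ?N t \<omega>))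
      = expectation (\<lambda>\<omega>. indicator A \<omega> * correction h t \<omega>)"
    unfolding eq using 2 W_int W_mean[OF root\<^sub>1] W_mean[OF root\<^sub>2] by simp
qed

lemma increment_bounds:
  assumes "a \<in> {p..q}"
  obtains C where "0 \<le> C"
    "\<And>x y. x \<in> {p..q} \<Longrightarrow> y \<in> {p..q} \<Longrightarrow> \<bar>u x - u y\<bar> \<le> C * \<bar>x - y\<bar>"
    "\<And>x y. x \<in> {p..q} \<Longrightarrow> y \<in> {p..q} \<Longrightarrow> \<bar>u x - u y\<bar> \<le> C * max \<bar>x - a\<bar> \<bar>y - a\<bar> * \<bar>x - y\<bar>"
proof (rule neumann_increment_bounds)
  show "(u has_real_derivative c\<^sub>1 * l\<^sub>1 * exp (l\<^sub>1 * x) + c\<^sub>2 * l\<^sub>2 * exp (l\<^sub>2 * x)) (at x)" for x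
    unfolding u_def by (auto intro!: derivative_eq_intros)
  show "((\<lambda>x. c\<^sub>1 * l\<^sub>1 * exp (l\<^sub>1 * x) + c\<^sub>2 * l\<^sub>2 * exp (l\<^sub>2 * x)) has_real_derivative
      c\<^sub>1 * l\<^sub>1 * l\<^sub>1 * exp (l\<^sub>1 * x) + c\<^sub>2 * l\<^sub>2 * l\<^sub>2 * exp (l\<^sub>2 * x)) (at x)" for x
    by (auto intro!: derivative_eq_intros)
  show "continuous_on UNIV (\<lambda>x. c\<^sub>1 * l\<^sub>1 * l\<^sub>1 * exp (l\<^sub>1 * x) + c\<^sub>2 * l\<^sub>2 * l\<^sub>2 * exp (l\<^sub>2 * x))"
    by (intro continuous_intros)
qed (use neumann assms that in auto)

definition steps :: "real \<Rightarrow> real \<Rightarrow> nat \<Rightarrow> nat \<Rightarrow> 'a \<Rightarrow> real" where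
  "steps K T n k \<omega> = indicator (alive K (real k * (T / real n))) \<omega> * correction (T / real n) (real k * (T / real n)) \<omega>"

abbreviation dB :: "real \<Rightarrow> nat \<Rightarrow> nat \<Rightarrow> 'a \<Rightarrow> real" where
  "dB T n k \<omega> \<equiv> B (real k * (T / real n) + T / real n) \<omega> - B (real k * (T / real n)) \<omega>"

lemma grid_Suc: "real (Suc k) * (T / real n) = real k * (T / real n) + T / real n"
  by (simp add: algebra_simps add_divide_distrib)

text \<open>Apart from the fixed data, the constant depends on \<open>T\<close> only, while \<open>w\<close> is arbitrary.  This pays twice: a crude \<open>w\<close> gives
  a bound that is uniform in \<open>n\<close> and the path, and the modulus of continuity of a fixed path gives
  convergence to 0.\<close>

lemma small_steps_bound:
  assumes T: "0 < T"
  obtains C where "0 \<le> C"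
    "\<And>K n w \<omega>. typical \<omega> \<Longrightarrow> \<omega> \<in> space M \<Longrightarrow> 0 \<le> K \<Longrightarrow> 0 < n \<Longrightarrow> 0 \<le> w \<Longrightarrow>
      (\<And>k. k < n \<Longrightarrow> \<bar>dB T n k \<omega>\<bar> \<le> 1 \<Longrightarrow> \<bar>\<mu> * (T / real n) + dB T n k \<omega>\<bar> \<le> w) \<Longrightarrow>
      (\<And>k s. k < n \<Longrightarrow> s \<in> {real k * (T / real n)..real (Suc k) * (T / real n)} \<Longrightarrow>
        \<bar>X s \<omega> - X (real k * (T / real n)) \<omega>\<bar> \<le> w) \<Longrightarrow>
      \<bar>\<Sum>k<n. if \<bar>dB T n k \<omega>\<bar> \<le> 1 then steps K T n k \<omega> else 0\<bar> \<le> C * w * (K + 1)"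
proof -
  \<comment> \<open>The free step from a point of \<open>{a..b}\<close> ends in \<open>{p..q}\<close> if the Brownian increment is at most 1.\<close>
  define p where "p = a - 1 - \<bar>\<mu>\<bar> * T"
  define q where "q = b + 1 + \<bar>\<mu>\<bar> * T"
  have "0 \<le> \<bar>\<mu>\<bar> * T" using T by simp
  then have pq: "{a..b} \<subseteq> {p..q}" by (auto simp: p_def q_def)
  have "a \<in> {p..q}" using pq a_le_b by auto
  then obtain C where C: "0 \<le> C"
    "\<And>x y. x \<in> {p..q} \<Longrightarrow> y \<in> {p..q} \<Longrightarrow> \<bar>u x - u y\<bar> \<le> C * \<bar>x - y\<bar>"
    "\<And>x y. x \<in> {p..q} \<Longrightarrow> y \<in> {p..q} \<Longrightarrow> \<bar>u x - u y\<bar> \<le> C * max \<bar>x - a\<bar> \<bar>y - a\<bar> * \<bar>x - y\<bar>"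
    using increment_bounds by blast
  show thesis
  proof (rule that[of "2 * C"])
    fix K w :: real and n :: nat and \<omega>
    assume typical: "typical \<omega>" and \<omega>: "\<omega> \<in> space M" and K: "0 \<le> K" and n: "0 < n" and w: "0 \<le> w"
      and y: "\<And>k. k < n \<Longrightarrow> \<bar>dB T n k \<omega>\<bar> \<le> 1 \<Longrightarrow> \<bar>\<mu> * (T / real n) + dB T n k \<omega>\<bar> \<le> w"
      and x: "\<And>k s. k < n \<Longrightarrow> s \<in> {real k * (T / real n)..real (Suc k) * (T / real n)} \<Longrightarrow>
        \<bar>X s \<omega> - X (real k * (T / real n)) \<omega>\<bar> \<le> w"
    interpret reflected_path "\<lambda>t. X t \<omega>" "\<lambda>t. \<eta> \<omega> + \<mu> * t + B t \<omega>" "\<lambda>t. L t \<omega>" "\<lambda>t. U t \<omega>" a b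
      using typical by (simp add: typical_def)
    define h where "h = T / real n"
    have h: "0 < h" "h \<le> T" using T n by (auto simp: h_def field_simps)
    define g where "g k = real k * h" for k
    have g: "0 \<le> g k" "g (Suc k) = g k + h" for k using h by (auto simp: g_def algebra_simps)
    have xg: "\<bar>X r \<omega> - X (g k) \<omega>\<bar> \<le> w" if "k < n" "r \<in> {g k..g (Suc k)}" for k r
      using x[OF that(1), of r] that(2) unfolding g_def h_def .
    define d where "d k = correction h (g k) \<omega>" for k
    have d_le: "\<bar>d k\<bar> \<le> \<bar>u (X (g (Suc k)) \<omega>) - u (X (g k) \<omega> + (\<mu> * h + dB T n k \<omega>))\<bar>" for k
    proof -
      have "d k = exp (- \<theta> * g (Suc k)) * (u (X (g (Suc k)) \<omega>) - u (X (g k) \<omega> + (\<mu> * h + dB T n k \<omega>)))"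
        by (simp only: d_def correction_def g(2)) (simp add: g_def h_def add.assoc)
      moreover have "exp (- \<theta> * g (Suc k)) \<le> 1" using rate_nonneg g(1)[of "Suc k"] by simp
      ultimately show ?thesis by (simp only: abs_mult abs_exp_cancel) (intro mult_left_le_one_le; simp)
    qed
    have in_pq: "X (g k) \<omega> \<in> {p..q}" for k
      using x_range[of "g k"] g pq by auto
    have drift: "\<bar>\<mu> * h\<bar> \<le> \<bar>\<mu>\<bar> * T" using h by (auto simp: abs_mult intro: mult_left_mono)
    have in_pq': "X (g k) \<omega> + (\<mu> * h + dB T n k \<omega>) \<in> {p..q}" if "\<bar>dB T n k \<omega>\<bar> \<le> 1" for k
      using x_range[of "g k"] g that drift by (auto simp: p_def q_def abs_le_iff)
    have "\<bar>\<Sum>k<n. if \<omega> \<in> alive K (g k) \<and> \<bar>dB T n k \<omega>\<bar> \<le> 1 then d k else 0\<bar> \<le> 2 * C * w * (K + 1)"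
    proof (rule stopped_correction_bound[where l = "\<lambda>k. L (g k) \<omega>"])
      show "\<omega> \<in> alive K (g k)" if "\<omega> \<in> alive K (g (Suc k))" for k
        using that alive_iff[OF typical \<omega>] g[of k] g(1)[of "Suc k"] l_mono[of "g k" "g (Suc k)"] h by auto
      show "L (g k) \<omega> \<le> L (g (Suc k)) \<omega>" for k using g h by (intro l_mono) auto
      show "0 \<le> L (g 0) \<omega>" by (simp add: g_def l_0)
      show "L (g k) \<omega> \<le> K" if "\<omega> \<in> alive K (g k)" for k using that by (simp add: alive_def)
      show "0 \<le> 2 * C * w" using C(1) w by simp
      show "\<bar>d k\<bar> \<le> 2 * C * w * (L (g (Suc k)) \<omega> - L (g k) \<omega>)"
        if k: "k < n" "\<bar>dB T n k \<omega>\<bar> \<le> 1" "\<omega> \<in> alive K (g (Suc k))" for k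
      proof -
        have lt: "g (Suc k) < passage \<omega>" using alive_iff[OF typical \<omega> g(1)] k(3) by simp
        have dy: "\<eta> \<omega> + \<mu> * g (Suc k) + B (g (Suc k)) \<omega> - (\<eta> \<omega> + \<mu> * g k + B (g k) \<omega>) = \<mu> * h + dB T n k \<omega>"
          by (simp add: g(2)) (simp add: g_def h_def algebra_simps)
        have "\<bar>u (X (g (Suc k)) \<omega>) - u (X (g k) \<omega> + (\<mu> * h + dB T n k \<omega>))\<bar>
            \<le> 2 * C * w * (L (g (Suc k)) \<omega> - L (g k) \<omega>)"
        proof (rule correction_bound[where s = "g k" and t = "g (Suc k)" and p = p and q = q, unfolded dy])
          show "X r \<omega> < b" if "r \<in> {g k..g (Suc k)}" for r
          proof -
            have "0 \<le> r" "r < passage \<omega>" using that lt g(1)[of k] by auto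
            then have "X r \<omega> < S" using typical unfolding typical_def by blast
            then show ?thesis using level_le by simp
          qed
          show "\<bar>\<mu> * h + dB T n k \<omega>\<bar> \<le> w" using y[OF k(1,2)] by (simp add: h_def)
          show "\<bar>X r \<omega> - X (g k) \<omega>\<bar> \<le> w" if "r \<in> {g k..g (Suc k)}" for r
            using xg[OF k(1) that] .
        qed (use g h C in_pq[of k] in_pq[of "Suc k"] in_pq'[OF k(2)] in auto)
        then show ?thesis using d_le[of k] by linarith
      qed
      show "\<bar>d k\<bar> \<le> 2 * C * w" if k: "k < n" "\<bar>dB T n k \<omega>\<bar> \<le> 1" for k
      proof -
        have "\<bar>X (g (Suc k)) \<omega> - X (g k) \<omega>\<bar> \<le> w"
          using xg[OF k(1), of "g (Suc k)"] g(2)[of k] h by simp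
        then have "C * \<bar>X (g (Suc k)) \<omega> - X (g k) \<omega>\<bar> \<le> C * w" using C(1) by (rule mult_left_mono)
        then have 1: "\<bar>u (X (g (Suc k)) \<omega>) - u (X (g k) \<omega>)\<bar> \<le> C * w"
          using C(2)[OF in_pq in_pq, of "Suc k" k] by linarith
        have "C * \<bar>\<mu> * h + dB T n k \<omega>\<bar> \<le> C * w"
          using y[OF k] C(1) by (intro mult_left_mono) (auto simp: h_def)
        then have 2: "\<bar>u (X (g k) \<omega> + (\<mu> * h + dB T n k \<omega>)) - u (X (g k) \<omega>)\<bar> \<le> C * w"
          using C(2)[OF in_pq'[OF k(2)] in_pq, of k] by simp
        show ?thesis using d_le[of k] 1 2 by linarith
      qed
    qed (use K in auto)
    also have "(\<Sum>k<n. if \<omega> \<in> alive K (g k) \<and> \<bar>dB T n k \<omega>\<bar> \<le> 1 then d k else 0)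
        = (\<Sum>k<n. if \<bar>dB T n k \<omega>\<bar> \<le> 1 then steps K T n k \<omega> else 0)"
      by (intro sum.cong) (auto simp: steps_def d_def g_def h_def)
    finally show "\<bar>\<Sum>k<n. if \<bar>dB T n k \<omega>\<bar> \<le> 1 then steps K T n k \<omega> else 0\<bar> \<le> 2 * C * w * (K + 1)" .
  qed (use C in auto)
qed

end

context neumann_eigenfunction
begin

lemma u_growth: "\<bar>u z\<bar> \<le> (\<bar>c\<^sub>1\<bar> + \<bar>c\<^sub>2\<bar>) * exp ((1 + \<bar>l\<^sub>1\<bar> + \<bar>l\<^sub>2\<bar>) * \<bar>z\<bar>)"
proof -
  have e: "exp (l * z) \<le> exp ((1 + \<bar>l\<^sub>1\<bar> + \<bar>l\<^sub>2\<bar>) * \<bar>z\<bar>)" if "\<bar>l\<bar> \<le> 1 + \<bar>l\<^sub>1\<bar> + \<bar>l\<^sub>2\<bar>" for l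
  proof -
    have "l * z \<le> \<bar>l\<bar> * \<bar>z\<bar>" by (metis abs_ge_self abs_mult)
    also have "\<dots> \<le> (1 + \<bar>l\<^sub>1\<bar> + \<bar>l\<^sub>2\<bar>) * \<bar>z\<bar>" using that by (intro mult_right_mono) auto
    finally show ?thesis by simp
  qed
  have "\<bar>u z\<bar> \<le> \<bar>c\<^sub>1\<bar> * exp (l\<^sub>1 * z) + \<bar>c\<^sub>2\<bar> * exp (l\<^sub>2 * z)"
    unfolding u_def by (rule order_trans[OF abs_triangle_ineq]) (simp add: abs_mult)
  also have "\<dots> \<le> \<bar>c\<^sub>1\<bar> * exp ((1 + \<bar>l\<^sub>1\<bar> + \<bar>l\<^sub>2\<bar>) * \<bar>z\<bar>) + \<bar>c\<^sub>2\<bar> * exp ((1 + \<bar>l\<^sub>1\<bar> + \<bar>l\<^sub>2\<bar>) * \<bar>z\<bar>)"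
    by (intro add_mono mult_left_mono e) auto
  finally show ?thesis by (simp add: algebra_simps)
qed

text \<open>The function \<open>u\<close> grows at most exponentially and the reflected path is bounded, so a correction is at
  most exponential in the Brownian increment.\<close>

lemma large_step_bound:
  assumes T: "0 < T"
  obtains C c where "0 \<le> C" "0 < c"
    "\<And>K n k \<omega>. typical \<omega> \<Longrightarrow> 0 < n \<Longrightarrow> 1 < \<bar>dB T n k \<omega>\<bar> \<Longrightarrow>
      \<bar>steps K T n k \<omega>\<bar> \<le> C * exp_quartic c (dB T n k \<omega>)"
proof -
  define c where "c = 1 + \<bar>l\<^sub>1\<bar> + \<bar>l\<^sub>2\<bar>"
  define G where "G = \<bar>c\<^sub>1\<bar> + \<bar>c\<^sub>2\<bar>"
  define R where "R = max \<bar>a\<bar> \<bar>b\<bar>"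
  have c: "0 < c" and G: "0 \<le> G" by (auto simp: c_def G_def)
  have muT: "0 \<le> \<bar>\<mu>\<bar> * T" using T by simp
  show thesis
  proof (rule that[of "2 * G * exp (c * (R + \<bar>\<mu>\<bar> * T)) / (1 - exp (- c)) ^ 4" c])
    fix K :: real and n k :: nat and \<omega> assume typical: "typical \<omega>" and n: "0 < n" and big: "1 < \<bar>dB T n k \<omega>\<bar>"
    interpret reflected_path "\<lambda>t. X t \<omega>" "\<lambda>t. \<eta> \<omega> + \<mu> * t + B t \<omega>" "\<lambda>t. L t \<omega>" "\<lambda>t. U t \<omega>" a b
      using typical by (simp add: typical_def)
    define h where "h = T / real n"
    define t where "t = real k * h"
    have h: "0 < h" "h \<le> T" using T n by (auto simp: h_def field_simps)
    have t: "0 \<le> t" using h by (simp add: t_def)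
    let ?d = "B (t + h) \<omega> - B t \<omega>"
    have d: "dB T n k \<omega> = ?d" by (simp add: t_def h_def)
    have R: "\<bar>X s \<omega>\<bar> \<le> R" if "0 \<le> s" for s using x_range[OF that] by (auto simp: R_def)
    have "\<bar>\<mu> * h\<bar> \<le> \<bar>\<mu>\<bar> * T" using h by (auto simp: abs_mult intro: mult_left_mono)
    then have "\<bar>X t \<omega> + \<mu> * h + ?d\<bar> \<le> R + \<bar>\<mu>\<bar> * T + \<bar>?d\<bar>" using R[OF t] by linarith
    then have 1: "\<bar>u (X t \<omega> + \<mu> * h + ?d)\<bar> \<le> G * exp (c * (R + \<bar>\<mu>\<bar> * T + \<bar>?d\<bar>))"
      using u_growth[of "X t \<omega> + \<mu> * h + ?d"] c G unfolding c_def[symmetric] G_def[symmetric]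
      by (elim order_trans) (intro mult_left_mono; simp)
    have "\<bar>X (t + h) \<omega>\<bar> \<le> R + \<bar>\<mu>\<bar> * T + \<bar>?d\<bar>" using R[of "t + h"] t h muT by linarith
    then have 2: "\<bar>u (X (t + h) \<omega>)\<bar> \<le> G * exp (c * (R + \<bar>\<mu>\<bar> * T + \<bar>?d\<bar>))"
      using u_growth[of "X (t + h) \<omega>"] c G unfolding c_def[symmetric] G_def[symmetric]
      by (elim order_trans) (intro mult_left_mono; simp)
    have "exp (- \<theta> * (t + h)) \<le> 1" using rate_nonneg t h by simp
    then have "\<bar>correction h t \<omega>\<bar> \<le> \<bar>u (X (t + h) \<omega>) - u (X t \<omega> + \<mu> * h + ?d)\<bar>"
      unfolding correction_def by (simp only: abs_mult abs_exp_cancel) (intro mult_left_le_one_le; simp)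
    also have "\<dots> \<le> 2 * G * exp (c * (R + \<bar>\<mu>\<bar> * T + \<bar>?d\<bar>))" using 1 2 by linarith
    also have "\<dots> = 2 * G * exp (c * (R + \<bar>\<mu>\<bar> * T)) * exp (c * \<bar>?d\<bar>)"
      by (simp add: exp_add[symmetric] algebra_simps)
    also have "\<dots> \<le> 2 * G * exp (c * (R + \<bar>\<mu>\<bar> * T)) * (exp_quartic c ?d / (1 - exp (- c)) ^ 4)"
      using G big d by (intro mult_left_mono exp_abs_le_quartic c) auto
    finally have *: "\<bar>correction h t \<omega>\<bar>
        \<le> 2 * G * exp (c * (R + \<bar>\<mu>\<bar> * T)) / (1 - exp (- c)) ^ 4 * exp_quartic c ?d" by simp
    have "\<bar>steps K T n k \<omega>\<bar> \<le> \<bar>correction h t \<omega>\<bar>"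
      by (auto simp: steps_def h_def t_def indicator_def)
    with * show "\<bar>steps K T n k \<omega>\<bar> \<le> 2 * G * exp (c * (R + \<bar>\<mu>\<bar> * T)) / (1 - exp (- c)) ^ 4 * exp_quartic c (dB T n k \<omega>)"
      unfolding d by linarith
  qed (use c G in auto)
qed

lemma integrable_steps:
  assumes "0 < T" "0 < n"
  shows "integrable M (steps K T n k)"
  unfolding steps_def[abs_def] using assms
  by (intro one_step(2) alive_measurable) auto

lemma dB_measurable:
  assumes "0 < T"
  shows "dB T n k \<in> borel_measurable M"
  using assms by (intro borel_measurable_diff BM_measurable) auto

text \<open>Steps with a Brownian increment of at most 1 are handled by dominated convergence, the others by
  their means.\<close>

lemma correction_limit:
  assumes T: "0 < T" and K: "0 \<le> K"
  shows "(\<lambda>n. expectation (\<lambda>\<omega>. \<Sum>k<n. steps K T n k \<omega>)) \<longlonglongrightarrow> 0"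
proof -
  define sm where "sm n k \<omega> = (if \<bar>dB T n k \<omega>\<bar> \<le> 1 then steps K T n k \<omega> else 0)" for n k \<omega>
  define lg where "lg n k \<omega> = (if \<bar>dB T n k \<omega>\<bar> \<le> 1 then 0 else steps K T n k \<omega>)" for n k \<omega>
  note [measurable] = dB_measurable[OF T]
  have int: "integrable M (sm n k)" "integrable M (lg n k)" if "0 < n" for n k
  proof -
    have i: "integrable M (steps K T n k)" by (rule integrable_steps[OF T that])
    then have [measurable]: "steps K T n k \<in> borel_measurable M" by simp
    have [measurable]: "sm n k \<in> borel_measurable M" "lg n k \<in> borel_measurable M"
      unfolding sm_def[abs_def] lg_def[abs_def] by measurable
    show "integrable M (sm n k)" "integrable M (lg n k)"
      by (rule Bochner_Integration.integrable_bound[OF i]; simp add: sm_def lg_def)+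
  qed
  obtain C where C: "0 \<le> C"
    "\<And>K n w \<omega>. typical \<omega> \<Longrightarrow> \<omega> \<in> space M \<Longrightarrow> 0 \<le> K \<Longrightarrow> 0 < n \<Longrightarrow> 0 \<le> w \<Longrightarrow>
      (\<And>k. k < n \<Longrightarrow> \<bar>dB T n k \<omega>\<bar> \<le> 1 \<Longrightarrow> \<bar>\<mu> * (T / real n) + dB T n k \<omega>\<bar> \<le> w) \<Longrightarrow>
      (\<And>k s. k < n \<Longrightarrow> s \<in> {real k * (T / real n)..real (Suc k) * (T / real n)} \<Longrightarrow>
        \<bar>X s \<omega> - X (real k * (T / real n)) \<omega>\<bar> \<le> w) \<Longrightarrow>
      \<bar>\<Sum>k<n. if \<bar>dB T n k \<omega>\<bar> \<le> 1 then steps K T n k \<omega> else 0\<bar> \<le> C * w * (K + 1)"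
    using small_steps_bound[OF T] by blast
  have small: "(\<lambda>n. expectation (\<lambda>\<omega>. \<Sum>k<n. sm n k \<omega>)) \<longlonglongrightarrow> expectation (\<lambda>_. 0)"
  proof (rule integral_dominated_convergence[where w = "\<lambda>_. C * (b - a + 1 + \<bar>\<mu>\<bar> * T) * (K + 1)"])
    show "(\<lambda>\<omega>. \<Sum>k<n. sm n k \<omega>) \<in> borel_measurable M" for n
      using int by (cases n) (auto intro!: borel_measurable_sum borel_measurable_integrable)
    show "AE \<omega> in M. (\<lambda>n. \<Sum>k<n. sm n k \<omega>) \<longlonglongrightarrow> 0"
      using AE_typical AE_space
    proof eventually_elim
      case (elim \<omega>)
      interpret reflected_path "\<lambda>t. X t \<omega>" "\<lambda>t. \<eta> \<omega> + \<mu> * t + B t \<omega>" "\<lambda>t. L t \<omega>" "\<lambda>t. U t \<omega>" a b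
        using elim by (simp add: typical_def)
      show ?case
      proof (rule LIMSEQ_I)
        fix e :: real assume e: "0 < e"
        \<comment> \<open>The added 1 makes the denominator positive even if \<open>C\<close> vanishes.\<close>
        define w where "w = e / (C * (K + 1) + 1)"
        have pos: "0 < C * (K + 1) + 1" using C(1) K by (simp add: add_nonneg_pos)
        then have w: "0 < w" using e by (simp add: w_def)
        have less: "C * w * (K + 1) < e"
        proof -
          have "w * (C * (K + 1)) < w * (C * (K + 1) + 1)" using w by simp
          also have "\<dots> = e" using pos by (simp add: w_def)
          finally show ?thesis by (simp add: mult_ac)
        qed
        have "\<forall>\<^sub>F n in sequentially. norm ((\<Sum>k<n. sm n k \<omega>) - 0) < e"
          using uniform_grid_modulus[OF x_cont T w] uniform_grid_modulus[OF y_cont T w] eventually_gt_at_top[of 0]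
        proof eventually_elim
          case (elim n)
          have "\<bar>\<Sum>k<n. sm n k \<omega>\<bar> \<le> C * w * (K + 1)"
            unfolding sm_def
          proof (rule C(2)[OF \<open>typical \<omega>\<close> \<open>\<omega> \<in> space M\<close> K elim(3)])
            fix k assume k: "k < n"
            have "\<bar>(\<eta> \<omega> + \<mu> * (real k * (T / real n) + T / real n) + B (real k * (T / real n) + T / real n) \<omega>)
                - (\<eta> \<omega> + \<mu> * (real k * (T / real n)) + B (real k * (T / real n)) \<omega>)\<bar> \<le> w"
              using elim(2)[rule_format, OF k, of "real (Suc k) * (T / real n)"] T
              unfolding grid_Suc by simp
            then show "\<bar>\<mu> * (T / real n) + dB T n k \<omega>\<bar> \<le> w" by (simp add: algebra_simps)
          qed (use elim(1) w in auto)
          then show ?case using less by simp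
        qed
        then show "\<exists>no. \<forall>n\<ge>no. norm ((\<Sum>k<n. sm n k \<omega>) - 0) < e"
          by (simp add: eventually_sequentially)
      qed
    qed
    show "AE \<omega> in M. norm (\<Sum>k<n. sm n k \<omega>) \<le> C * (b - a + 1 + \<bar>\<mu>\<bar> * T) * (K + 1)" for n
      using AE_typical AE_space
    proof eventually_elim
      case (elim \<omega>)
      interpret reflected_path "\<lambda>t. X t \<omega>" "\<lambda>t. \<eta> \<omega> + \<mu> * t + B t \<omega>" "\<lambda>t. L t \<omega>" "\<lambda>t. U t \<omega>" a b
        using elim by (simp add: typical_def)
      have muT: "0 \<le> \<bar>\<mu>\<bar> * T" using T by simp
      have w: "0 \<le> b - a + 1 + \<bar>\<mu>\<bar> * T" using muT a_le_b by linarith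
      show ?case
      proof (cases "n = 0")
        case True
        then show ?thesis using C(1) K w by simp
      next
        case False
        have "\<bar>\<Sum>k<n. sm n k \<omega>\<bar> \<le> C * (b - a + 1 + \<bar>\<mu>\<bar> * T) * (K + 1)"
          unfolding sm_def
        proof (rule C(2)[OF elim K])
          fix k assume "\<bar>dB T n k \<omega>\<bar> \<le> 1"
          moreover have "\<bar>\<mu> * (T / real n)\<bar> \<le> \<bar>\<mu>\<bar> * T"
            unfolding abs_mult using T False by (intro mult_left_mono) (auto simp: field_simps)
          ultimately show "\<bar>\<mu> * (T / real n) + dB T n k \<omega>\<bar> \<le> b - a + 1 + \<bar>\<mu>\<bar> * T"
            using a_le_b by linarith
        next
          fix k s assume s: "s \<in> {real k * (T / real n)..real (Suc k) * (T / real n)}"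
          have k: "0 \<le> real k * (T / real n)" using T by simp
          then have "0 \<le> s" using s by (meson atLeastAtMost_iff order_trans)
          then have "X s \<omega> \<in> {a..b}" "X (real k * (T / real n)) \<omega> \<in> {a..b}"
            using k by (blast intro: x_range)+
          then show "\<bar>X s \<omega> - X (real k * (T / real n)) \<omega>\<bar> \<le> b - a + 1 + \<bar>\<mu>\<bar> * T" using muT by auto
        qed (use False w in auto)
        then show ?thesis by simp
      qed
    qed
  qed auto
  obtain D c where D: "0 \<le> D" "0 < c"
    "\<And>K n k \<omega>. typical \<omega> \<Longrightarrow> 0 < n \<Longrightarrow> 1 < \<bar>dB T n k \<omega>\<bar> \<Longrightarrow>
      \<bar>steps K T n k \<omega>\<bar> \<le> D * exp_quartic c (dB T n k \<omega>)"
    using large_step_bound[OF T] by blast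
  have large: "(\<lambda>n. \<Sum>k<n. expectation (lg n k)) \<longlonglongrightarrow> 0"
  proof (rule Lim_null_comparison)
    define \<beta> where "\<beta> = c\<^sup>2 * T"
    show "(\<lambda>n. D * (real n * (2 * exp (2 * \<beta> / real n) - 8 * exp (\<beta> / real n / 2) + 6))) \<longlonglongrightarrow> 0"
      using tendsto_mult_left[OF exp_quartic_mean_limit, of D \<beta>] by simp
    show "\<forall>\<^sub>F n in sequentially. norm (\<Sum>k<n. expectation (lg n k))
        \<le> D * (real n * (2 * exp (2 * \<beta> / real n) - 8 * exp (\<beta> / real n / 2) + 6))"
      using eventually_gt_at_top[of 0]
    proof eventually_elim
      case (elim n)
      have h: "0 < T / real n" using T elim by simp
      have le: "norm (expectation (lg n k)) \<le> D * (2 * exp (2 * \<beta> / real n) - 8 * exp (\<beta> / real n / 2) + 6)" for k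
      proof -
        have N: "distributed M lborel (dB T n k) (normal_density 0 (sqrt (T / real n)))"
          using T h by (intro increment_normal) auto
        have s: "0 < sqrt (T / real n)" using h by simp
        have i: "integrable M (\<lambda>\<omega>. D * exp_quartic c (dB T n k \<omega>))"
          using integrable_exp_quartic_normal[OF N s] by simp
        have "norm (expectation (lg n k)) \<le> expectation (\<lambda>\<omega>. \<bar>lg n k \<omega>\<bar>)"
          by (simp add: integral_abs_bound)
        also have "\<dots> \<le> expectation (\<lambda>\<omega>. D * exp_quartic c (dB T n k \<omega>))"
        proof (rule integral_mono_AE)
          show "AE \<omega> in M. \<bar>lg n k \<omega>\<bar> \<le> D * exp_quartic c (dB T n k \<omega>)"
            using AE_typical
            by eventually_elim (use D elim exp_quartic_nonneg in \<open>auto simp: lg_def\<close>)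
        qed (use int[OF elim] i in auto)
        also have "\<dots> = D * (2 * exp (2 * \<beta> / real n) - 8 * exp (\<beta> / real n / 2) + 6)"
          using expectation_exp_quartic_normal[OF N s, of c] h by (simp add: \<beta>_def)
        finally show ?thesis .
      qed
      have "norm (\<Sum>k<n. expectation (lg n k)) \<le> (\<Sum>k<n. D * (2 * exp (2 * \<beta> / real n) - 8 * exp (\<beta> / real n / 2) + 6))"
        by (rule sum_norm_le) (rule le)
      then show ?case by (simp add: mult_ac)
    qed
  qed
  have "expectation (\<lambda>\<omega>. \<Sum>k<n. steps K T n k \<omega>)
      = expectation (\<lambda>\<omega>. \<Sum>k<n. sm n k \<omega>) + (\<Sum>k<n. expectation (lg n k))" for n
  proof (cases "n = 0")
    case False
    have "(\<Sum>k<n. steps K T n k \<omega>) = (\<Sum>k<n. sm n k \<omega>) + (\<Sum>k<n. lg n k \<omega>)" for \<omega>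
      unfolding sum.distrib[symmetric] by (intro sum.cong) (auto simp: sm_def lg_def)
    then show ?thesis using int False by (simp add: Bochner_Integration.integral_sum)
  qed simp
  then show ?thesis using tendsto_add[OF small large] by simp
qed

end

section \<open>Optional stopping at the passage time\<close>

lemma (in prob_space) prob_ge_of_nat_tendsto_0:
  fixes Y :: "'a \<Rightarrow> real"
  assumes [measurable]: "Y \<in> borel_measurable M"
  shows "(\<lambda>n. prob {\<omega> \<in> space M. real n \<le> Y \<omega>}) \<longlonglongrightarrow> 0"
proof -
  have "(\<lambda>n. prob {\<omega> \<in> space M. real n \<le> Y \<omega>}) \<longlonglongrightarrow> prob (\<Inter>n. {\<omega> \<in> space M. real n \<le> Y \<omega>})"
    by (rule finite_Lim_measure_decseq) (auto simp: decseq_def)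
  also have "(\<Inter>n. {\<omega> \<in> space M. real n \<le> Y \<omega>}) = {}"
  proof -
    have "\<exists>n. \<not> real n \<le> Y \<omega>" for \<omega>
      using reals_Archimedean2[of "Y \<omega>"] by (auto simp: not_le)
    then show ?thesis by auto
  qed
  finally show ?thesis by simp
qed

context neumann_eigenfunction
begin

definition discounted :: "real \<Rightarrow> 'a \<Rightarrow> real" where
  "discounted t \<omega> = exp (- \<theta> * t) * u (X t \<omega>)"

lemma discounted_le:
  assumes C: "\<And>x. x \<in> {a..b} \<Longrightarrow> \<bar>u x\<bar> \<le> C" and "typical \<omega>" and t: "0 \<le> t"
  shows "\<bar>discounted t \<omega>\<bar> \<le> C"
proof -
  interpret reflected_path "\<lambda>t. X t \<omega>" "\<lambda>t. \<eta> \<omega> + \<mu> * t + B t \<omega>" "\<lambda>t. L t \<omega>" "\<lambda>t. U t \<omega>" a b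
    using assms by (simp add: typical_def)
  have "exp (- \<theta> * t) \<le> 1" using rate_nonneg t by simp
  then have "\<bar>discounted t \<omega>\<bar> \<le> \<bar>u (X t \<omega>)\<bar>"
    unfolding discounted_def abs_mult abs_exp_cancel by (intro mult_left_le_one_le; simp)
  also have "\<dots> \<le> C" by (rule C[OF x_range[OF t]])
  finally show ?thesis .
qed

text \<open>Optional stopping for bounded time and bounded \<open>L\<close>: on the event that \<open>\<tau> < T\<close> and \<open>L T < K\<close>, the grid
  point at which the sum of increments is stopped converges to \<open>\<tau>\<close>; on its complement the
  discounted process is merely bounded by \<open>C\<close>.\<close>

lemma passage_gap_bound:
  assumes T: "0 < T" and K: "0 \<le> K" and C: "\<And>x. x \<in> {a..b} \<Longrightarrow> \<bar>u x\<bar> \<le> C"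
  shows "\<bar>expectation (\<lambda>\<omega>. exp (- \<theta> * passage \<omega>) * u S) - expectation (\<lambda>\<omega>. u (X 0 \<omega>))\<bar>
    \<le> 2 * C * (prob {\<omega> \<in> space M. T \<le> passage \<omega>} + prob {\<omega> \<in> space M. K \<le> L T \<omega>})"
proof -
  define g where "g n k = real k * (T / real n)" for n k
  have g_pos: "0 \<le> g n k" for n k using T by (simp add: g_def)
  have g_Suc: "g n (Suc k) = g n k + T / real n" for n k by (simp only: g_def grid_Suc)
  define Sn where "Sn n \<omega> = (\<Sum>k<n. indicator (alive K (g n k)) \<omega> *
    (discounted (g n k + T / real n) \<omega> - discounted (g n k) \<omega>))" for n \<omega>
  define gain where "gain \<omega> = exp (- \<theta> * passage \<omega>) * u S - u (X 0 \<omega>)" for \<omega>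
  define F where "F = {\<omega> \<in> space M. passage \<omega> < T \<and> L T \<omega> < K}"
  define W where "W n \<omega> = \<bar>Sn n \<omega> - gain \<omega>\<bar>" for n \<omega>
  have [measurable]: "X 0 \<in> borel_measurable M" "L T \<in> borel_measurable M"
    using T by (auto intro: X_measurable L_measurable)
  have F [measurable]: "F \<in> events" unfolding F_def by measurable
  have stopped: "\<exists>j\<le>n. (\<forall>k<n. g n k < passage \<omega> \<and> L (g n k) \<omega> \<le> K \<longleftrightarrow> k < j) \<and>
      Sn n \<omega> - gain \<omega> = discounted (g n j) \<omega> - discounted (passage \<omega>) \<omega>"
    if typical: "typical \<omega>" and \<omega>: "\<omega> \<in> space M" for n \<omega>
  proof -
    interpret reflected_path "\<lambda>t. X t \<omega>" "\<lambda>t. \<eta> \<omega> + \<mu> * t + B t \<omega>" "\<lambda>t. L t \<omega>" "\<lambda>t. U t \<omega>" a b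
      using typical by (simp add: typical_def)
    note alive = alive_iff[OF typical \<omega> g_pos]
    have "\<omega> \<in> alive K (g n k)" if "\<omega> \<in> alive K (g n (Suc k))" for k
    proof -
      have "g n k \<le> g n (Suc k)" using T by (simp add: g_Suc)
      then show ?thesis using that l_mono[OF g_pos, of n k "g n (Suc k)"] unfolding alive by auto
    qed
    from stopped_telescope[of "\<lambda>k. \<omega> \<in> alive K (g n k)" n "\<lambda>k. discounted (g n k) \<omega>", OF this]
    obtain j where j: "j \<le> n" "\<forall>k<n. \<omega> \<in> alive K (g n k) \<longleftrightarrow> k < j"
      "(\<Sum>k<n. if \<omega> \<in> alive K (g n k) then discounted (g n (Suc k)) \<omega> - discounted (g n k) \<omega> else 0)
        = discounted (g n j) \<omega> - discounted (g n 0) \<omega>" by blast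
    have "Sn n \<omega> = discounted (g n j) \<omega> - discounted (g n 0) \<omega>"
      unfolding Sn_def j(3)[symmetric] by (intro sum.cong) (auto simp: g_Suc)
    moreover have "gain \<omega> = discounted (passage \<omega>) \<omega> - discounted (g n 0) \<omega>"
      using typical by (simp add: gain_def discounted_def typical_def g_def)
    ultimately show ?thesis using j(1,2) unfolding alive by auto
  qed
  have W_le: "AE \<omega> in M. W n \<omega> \<le> 2 * C" for n
    using AE_typical AE_space
  proof eventually_elim
    case (elim \<omega>)
    obtain j where "Sn n \<omega> - gain \<omega> = discounted (g n j) \<omega> - discounted (passage \<omega>) \<omega>"
      using stopped[OF elim] by blast
    moreover have "0 \<le> passage \<omega>" using elim by (simp add: typical_def)
    ultimately show ?case
      using discounted_le[OF C elim(1) g_pos, of n j] discounted_le[OF C elim(1), of "passage \<omega>"]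
      unfolding W_def by linarith
  qed
  have C_nonneg: "0 \<le> C" using C[of a] a_le_b by auto
  have gain_int: "integrable M gain"
  proof (rule integrable_const_bound[of _ "2 * C"])
    show "gain \<in> borel_measurable M" unfolding gain_def[abs_def] by measurable
    have "\<bar>gain \<omega>\<bar> \<le> 2 * C" if typical: "typical \<omega>" for \<omega>
      using discounted_le[OF C typical, of 0] discounted_le[OF C typical, of "passage \<omega>"] typical
      unfolding gain_def by (simp add: discounted_def typical_def)
    then show "AE \<omega> in M. norm (gain \<omega>) \<le> 2 * C" using AE_typical by (auto elim!: eventually_mono)
  qed
  have Sn_int: "integrable M (Sn n)" for n
  proof (cases "n = 0")
    case False
    then show ?thesis
      unfolding Sn_def[abs_def] discounted_def using T g_pos
      by (intro Bochner_Integration.integrable_sum one_step(1) alive_measurable) auto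
  qed (simp add: Sn_def[abs_def])
  have Sn_mean: "expectation (Sn n) = expectation (\<lambda>\<omega>. \<Sum>k<n. steps K T n k \<omega>)" for n
  proof (cases "n = 0")
    case False
    have "expectation (Sn n) = (\<Sum>k<n. expectation (\<lambda>\<omega>. indicator (alive K (g n k)) \<omega> *
        (discounted (g n k + T / real n) \<omega> - discounted (g n k) \<omega>)))"
      unfolding Sn_def[abs_def] discounted_def using T False g_pos
      by (intro Bochner_Integration.integral_sum one_step(1) alive_measurable) auto
    also have "\<dots> = (\<Sum>k<n. expectation (steps K T n k))"
      unfolding steps_def[abs_def] discounted_def g_def[symmetric] using T False g_pos
      by (intro sum.cong refl one_step(3) alive_measurable) auto
    also have "\<dots> = expectation (\<lambda>\<omega>. \<Sum>k<n. steps K T n k \<omega>)"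
      using T False by (intro Bochner_Integration.integral_sum[symmetric] integrable_steps) auto
    finally show ?thesis .
  qed (simp add: Sn_def[abs_def])
  have W_int: "integrable M (W n)" for n
    unfolding W_def[abs_def] using Sn_int gain_int by (intro integrable_abs Bochner_Integration.integrable_diff)
  have lim: "(\<lambda>n. expectation (\<lambda>\<omega>. W n \<omega> * indicator F \<omega>)) \<longlonglongrightarrow> expectation (\<lambda>_. 0)"
  proof (rule integral_dominated_convergence[where w = "\<lambda>_. 2 * C"])
    show "(\<lambda>\<omega>. W n \<omega> * indicator F \<omega>) \<in> borel_measurable M" for n
      using W_int[of n] by (intro borel_measurable_times borel_measurable_integrable borel_measurable_indicator F) auto
    show "AE \<omega> in M. norm (W n \<omega> * indicator F \<omega>) \<le> 2 * C" for n
      using W_le[of n] by eventually_elim (use C_nonneg in \<open>auto simp: W_def indicator_def\<close>)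
    show "AE \<omega> in M. (\<lambda>n. W n \<omega> * indicator F \<omega>) \<longlonglongrightarrow> 0"
      using AE_typical AE_space
    proof eventually_elim
      case (elim \<omega>)
      note typical = elim(1)
      interpret reflected_path "\<lambda>t. X t \<omega>" "\<lambda>t. \<eta> \<omega> + \<mu> * t + B t \<omega>" "\<lambda>t. L t \<omega>" "\<lambda>t. U t \<omega>" a b
        using typical by (simp add: typical_def)
      show ?case
      proof (cases "\<omega> \<in> F")
        case True
        then have p: "0 < passage \<omega>" "passage \<omega> < T" "L T \<omega> < K"
          using typical by (auto simp: F_def typical_def)
        have cont: "continuous_on {0..} (\<lambda>t. discounted t \<omega>)"
          unfolding discounted_def u_def by (intro continuous_intros x_cont)
        have close: "\<exists>s\<ge>0. \<bar>s - passage \<omega>\<bar> \<le> T / real n \<and> W n \<omega> = \<bar>discounted s \<omega> - discounted (passage \<omega>) \<omega>\<bar>"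
          if n: "0 < n" for n
        proof -
          obtain j where j: "j \<le> n" "\<forall>k<n. g n k < passage \<omega> \<and> L (g n k) \<omega> \<le> K \<longleftrightarrow> k < j"
            "Sn n \<omega> - gain \<omega> = discounted (g n j) \<omega> - discounted (passage \<omega>) \<omega>"
            using stopped[OF elim] by blast
          have alive: "g n k < passage \<omega> \<longleftrightarrow> k < j" if "k < n" for k
          proof -
            have "L (g n k) \<omega> \<le> K" if "g n k < passage \<omega>"
              using l_mono[OF g_pos, of n k T] that p by simp
            then show ?thesis using j(2) that \<open>k < n\<close> by blast
          qed
          \<comment> \<open>The sum stops at the first grid point not before the passage.\<close>
          have "g n 0 < passage \<omega>" using p by (simp add: g_def)
          then obtain i where i: "j = Suc i" using alive[OF n] by (cases j) auto
          then have "g n i < passage \<omega>" using alive[of i] j(1) by auto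
          moreover have "passage \<omega> \<le> g n j"
          proof (cases "j < n")
            case True
            then show ?thesis using alive[of j] by auto
          next
            case False
            then have "g n j = T" using j(1) n by (simp add: g_def)
            then show ?thesis using p by simp
          qed
          ultimately have "\<bar>g n j - passage \<omega>\<bar> \<le> T / real n" unfolding i g_Suc by linarith
          then show ?thesis using g_pos j(3) unfolding W_def by auto
        qed
        have "(\<lambda>n. W n \<omega>) \<longlonglongrightarrow> 0"
        proof (rule LIMSEQ_I)
          fix e :: real assume "0 < e"
          then obtain d where d: "0 < d" "\<And>s. 0 \<le> s \<Longrightarrow> dist s (passage \<omega>) < d \<Longrightarrow>
              dist (discounted s \<omega>) (discounted (passage \<omega>) \<omega>) < e"
            using cont[unfolded continuous_on_iff, rule_format, of "passage \<omega>" e] p by auto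
          have "\<forall>\<^sub>F n in sequentially. T / real n < d"
            using lim_const_over_n[of T] d(1) by (rule order_tendstoD)
          then have "\<forall>\<^sub>F n in sequentially. norm (W n \<omega> - 0) < e"
            using eventually_gt_at_top[of 0]
          proof eventually_elim
            case (elim n)
            obtain s where s: "0 \<le> s" "\<bar>s - passage \<omega>\<bar> \<le> T / real n"
              "W n \<omega> = \<bar>discounted s \<omega> - discounted (passage \<omega>) \<omega>\<bar>" using close[OF elim(2)] by blast
            then show ?case using d(2)[of s] elim(1) by (simp add: dist_real_def)
          qed
          then show "\<exists>no. \<forall>n\<ge>no. norm (W n \<omega> - 0) < e" by (simp add: eventually_sequentially)
        qed
        then show ?thesis using True by simp
      qed simp
    qed
  qed auto
  have bound: "\<bar>expectation gain\<bar> \<le> \<bar>expectation (\<lambda>\<omega>. \<Sum>k<n. steps K T n k \<omega>)\<bar>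
      + expectation (\<lambda>\<omega>. W n \<omega> * indicator F \<omega>) + 2 * C * prob (space M - F)" for n
  proof -
    have WF: "integrable M (\<lambda>\<omega>. W n \<omega> * indicator F \<omega>)"
      by (rule integrable_real_mult_indicator[OF F W_int])
    have CF: "integrable M (\<lambda>\<omega>. 2 * C * indicator (space M - F) \<omega>)"
      using F by (intro integrable_mult_right integrable_real_indicator) (auto simp: less_top[symmetric])
    have "expectation (W n) \<le> expectation (\<lambda>\<omega>. W n \<omega> * indicator F \<omega> + 2 * C * indicator (space M - F) \<omega>)"
    proof (rule integral_mono_AE[OF W_int])
      show "integrable M (\<lambda>\<omega>. W n \<omega> * indicator F \<omega> + 2 * C * indicator (space M - F) \<omega>)"
        using WF CF by (rule Bochner_Integration.integrable_add)
      show "AE \<omega> in M. W n \<omega> \<le> W n \<omega> * indicator F \<omega> + 2 * C * indicator (space M - F) \<omega>"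
        using W_le[of n] AE_space by eventually_elim (auto simp: indicator_def)
    qed
    also have "\<dots> = expectation (\<lambda>\<omega>. W n \<omega> * indicator F \<omega>) + 2 * C * prob (space M - F)"
      by (subst Bochner_Integration.integral_add[OF WF CF]) (simp add: Int_absorb2)
    finally have EW: "expectation (W n) \<le> expectation (\<lambda>\<omega>. W n \<omega> * indicator F \<omega>) + 2 * C * prob (space M - F)" .
    have "\<bar>expectation (Sn n) - expectation gain\<bar> \<le> expectation (W n)"
      unfolding W_def[abs_def] Bochner_Integration.integral_diff[OF Sn_int gain_int, symmetric]
      by (rule integral_abs_bound)
    with EW show ?thesis unfolding Sn_mean by linarith
  qed
  have "(\<lambda>n. \<bar>expectation (\<lambda>\<omega>. \<Sum>k<n. steps K T n k \<omega>)\<bar>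
      + expectation (\<lambda>\<omega>. W n \<omega> * indicator F \<omega>) + 2 * C * prob (space M - F))
      \<longlonglongrightarrow> \<bar>0\<bar> + expectation (\<lambda>_. 0) + 2 * C * prob (space M - F)"
    by (intro tendsto_add tendsto_const lim tendsto_rabs correction_limit T K)
  then have "\<bar>expectation gain\<bar> \<le> \<bar>0\<bar> + expectation (\<lambda>_. 0) + 2 * C * prob (space M - F)"
    by (rule LIMSEQ_le_const) (use bound in auto)
  also have "\<dots> \<le> 2 * C * (prob {\<omega> \<in> space M. T \<le> passage \<omega>} + prob {\<omega> \<in> space M. K \<le> L T \<omega>})"
  proof -
    have "prob (space M - F) \<le> prob ({\<omega> \<in> space M. T \<le> passage \<omega>} \<union> {\<omega> \<in> space M. K \<le> L T \<omega>})"
      by (rule finite_measure_mono) (auto simp: F_def)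
    also have "\<dots> \<le> prob {\<omega> \<in> space M. T \<le> passage \<omega>} + prob {\<omega> \<in> space M. K \<le> L T \<omega>}"
      by (rule measure_Un_le) auto
    finally show ?thesis using C_nonneg by (simp add: mult_left_mono)
  qed
  also have "expectation gain = expectation (\<lambda>\<omega>. exp (- \<theta> * passage \<omega>) * u S) - expectation (\<lambda>\<omega>. u (X 0 \<omega>))"
  proof -
    have "integrable M (\<lambda>\<omega>. gain \<omega> + u (X 0 \<omega>))"
      using gain_int integrable_u_X[of 0] by simp
    then have "integrable M (\<lambda>\<omega>. exp (- \<theta> * passage \<omega>) * u S)" by (simp add: gain_def)
    then show ?thesis
      unfolding gain_def[abs_def] by (rule Bochner_Integration.integral_diff) (simp add: integrable_u_X)
  qed
  finally show ?thesis .
qed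

lemma passage_identity:
  "expectation (\<lambda>\<omega>. exp (- \<theta> * passage \<omega>)) * u S = expectation (\<lambda>\<omega>. u (X 0 \<omega>))"
proof -
  obtain C where C: "0 \<le> C" "\<And>x. x \<in> {a..b} \<Longrightarrow> \<bar>u x\<bar> \<le> C" using u_bounded by blast
  let ?gap = "\<bar>expectation (\<lambda>\<omega>. exp (- \<theta> * passage \<omega>) * u S) - expectation (\<lambda>\<omega>. u (X 0 \<omega>))\<bar>"
  have 1: "?gap \<le> 2 * C * (prob {\<omega> \<in> space M. T \<le> passage \<omega>} + 0)" if T: "0 < T" for T
  proof (rule LIMSEQ_le_const)
    show "(\<lambda>n. 2 * C * (prob {\<omega> \<in> space M. T \<le> passage \<omega>} + prob {\<omega> \<in> space M. real n \<le> L T \<omega>}))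
        \<longlonglongrightarrow> 2 * C * (prob {\<omega> \<in> space M. T \<le> passage \<omega>} + 0)"
      using T by (intro tendsto_intros prob_ge_of_nat_tendsto_0 L_measurable) auto
  qed (use passage_gap_bound[OF T _ C(2)] in auto)
  have "?gap \<le> 2 * C * (0 + 0)"
  proof (rule LIMSEQ_le_const)
    show "(\<lambda>n. 2 * C * (prob {\<omega> \<in> space M. real n \<le> passage \<omega>} + 0)) \<longlonglongrightarrow> 2 * C * (0 + 0)"
      by (intro tendsto_intros prob_ge_of_nat_tendsto_0 passage_random_variable)
    show "\<exists>N. \<forall>n\<ge>N. ?gap \<le> 2 * C * (prob {\<omega> \<in> space M. real n \<le> passage \<omega>} + 0)"
      by (intro exI[of _ 1] allI impI 1) simp
  qed
  then show ?thesis by simp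
qed

end

section \<open>Laplace transforms\<close>

lemma prob_density_on_integrable:
  assumes "prob_density_on I f"
  shows "integrable lborel f"
  using assms not_integrable_integral_eq[of lborel f] by (auto simp: prob_density_on_def)

lemma prob_density_on_measure:
  assumes f: "prob_density_on I f"
  shows "real_distribution (density lborel f)"
    and "A \<in> sets borel \<Longrightarrow> measure (density lborel f) A = (LBINT x:A. f x)"
proof -
  have [measurable]: "f \<in> borel_measurable borel" and nonneg: "\<And>x. 0 \<le> f x"
    using f by (auto simp: prob_density_on_def)
  have "emeasure (density lborel f) UNIV = ennreal (LBINT x. f x)"
    using nonneg prob_density_on_integrable[OF f]
    by (simp add: emeasure_density nn_integral_eq_integral)
  also have "\<dots> = 1" using f by (simp add: prob_density_on_def)
  finally have "prob_space (density lborel f)" by (intro prob_spaceI) simp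
  then show "real_distribution (density lborel f)"
    by (simp add: real_distribution_def real_distribution_axioms_def)
  assume A [measurable]: "A \<in> sets borel"
  have "measure (density lborel f) A = (\<integral>x. indicator A x \<partial>density lborel f)" by simp
  also have "\<dots> = (LBINT x. f x *\<^sub>R indicator A x)"
    using nonneg by (intro integral_density) auto
  finally show "measure (density lborel f) A = (LBINT x:A. f x)"
    by (simp add: set_lebesgue_integral_def mult.commute)
qed

lemma first_passage_time_nonneg: "0 \<le> first_passage_time X S \<omega>"
  unfolding first_passage_time_def by (rule INF_greatest) auto

lemma first_passage_density_cdf:
  assumes "first_passage_density M X S f" and t: "0 \<le> t"
  shows "measure M {\<omega> \<in> space M. first_passage_time X S \<omega> \<le> ereal t} = cdf (density lborel f) t"
proof -
  have f: "prob_density_on {0<..} f" using assms by (simp add: first_passage_density_def)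
  have "cdf (density lborel f) t = (LBINT s:{..t}. f s)"
    unfolding cdf_def by (rule prob_density_on_measure(2)[OF f]) simp
  also have "\<dots> = (LBINT s:{0..t}. f s)"
    unfolding set_lebesgue_integral_def
    by (rule Bochner_Integration.integral_cong) (use f t in \<open>auto simp: prob_density_on_def indicator_def\<close>)
  finally show ?thesis using assms by (simp add: first_passage_density_def)
qed

text \<open>The defect \<open>P (\<tau> = \<infinity>)\<close> is 1 minus the total mass of the density.\<close>

lemma (in prob_space) first_passage_density_finite:
  assumes f: "first_passage_density M X S f"
  shows "AE \<omega> in M. first_passage_time X S \<omega> < \<infinity>"
proof -
  have [measurable]: "first_passage_time X S \<in> borel_measurable M"
    using f by (simp add: first_passage_density_def)
  interpret D: real_distribution "density lborel f"
    using f by (intro prob_density_on_measure) (auto simp: first_passage_density_def)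
  have "(\<lambda>n. prob {\<omega> \<in> space M. first_passage_time X S \<omega> \<le> ereal (real n)})
      \<longlonglongrightarrow> prob (\<Union>n. {\<omega> \<in> space M. first_passage_time X S \<omega> \<le> ereal (real n)})"
    by (rule finite_Lim_measure_incseq) (auto simp: incseq_def intro: order_trans)
  moreover have "(\<lambda>n. prob {\<omega> \<in> space M. first_passage_time X S \<omega> \<le> ereal (real n)}) \<longlonglongrightarrow> 1"
    using filterlim_compose[OF D.cdf_lim_at_top_prob filterlim_real_sequentially]
    by (simp add: first_passage_density_cdf[OF f])
  ultimately have "prob (\<Union>n. {\<omega> \<in> space M. first_passage_time X S \<omega> \<le> ereal (real n)}) = 1"
    by (rule LIMSEQ_unique)
  then have "AE \<omega> in M. \<omega> \<in> (\<Union>n. {\<omega> \<in> space M. first_passage_time X S \<omega> \<le> ereal (real n)})"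
    by (intro prob_eq_1[THEN iffD1]) auto
  then show ?thesis by eventually_elim (auto intro: le_less_trans)
qed

lemma (in passage_from_below) distr_passage:
  assumes f: "first_passage_density M X S f"
  shows "distr M borel passage = density lborel f"
proof (rule cdf_unique)
  have pd: "prob_density_on {0<..} f" using f by (simp add: first_passage_density_def)
  show "real_distribution (distr M borel passage)" by simp
  show "real_distribution (density lborel f)" by (rule prob_density_on_measure(1)[OF pd])
  have [measurable]: "first_passage_time X S \<in> borel_measurable M" by (rule passage_measurable)
  show "cdf (distr M borel passage) = cdf (density lborel f)"
  proof
    fix t
    have eq: "cdf (distr M borel passage) t = prob {\<omega> \<in> space M. passage \<omega> \<le> t}"
      unfolding cdf_def by (subst measure_distr) (auto intro!: arg_cong[where f=prob])
    show "cdf (distr M borel passage) t = cdf (density lborel f) t"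
    proof (cases "0 \<le> t")
      case True
      have "AE \<omega> in M. passage \<omega> \<le> t \<longleftrightarrow> first_passage_time X S \<omega> \<le> ereal t"
        using passage_finite
      proof eventually_elim
        case (elim \<omega>)
        then show ?case using first_passage_time_nonneg[of X S \<omega>]
          by (cases "first_passage_time X S \<omega>") (auto simp: passage_def)
      qed
      then have "prob {\<omega> \<in> space M. passage \<omega> \<le> t}
          = prob {\<omega> \<in> space M. first_passage_time X S \<omega> \<le> ereal t}"
        by (intro finite_measure_eq_AE) auto
      then show ?thesis unfolding eq first_passage_density_cdf[OF f True] .
    next
      case False
      have "{\<omega> \<in> space M. passage \<omega> \<le> t} = {}"
      proof -
        have "0 \<le> passage \<omega>" for \<omega>
          unfolding passage_def by (rule real_of_ereal_pos[OF first_passage_time_nonneg])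
        then show ?thesis using False by (auto dest: order_trans)
      qed
      moreover have "cdf (density lborel f) t = 0"
      proof -
        have "cdf (density lborel f) t = (LBINT s:{..t}. f s)"
          unfolding cdf_def by (rule prob_density_on_measure(2)[OF pd]) simp
        also have "\<dots> = 0"
          unfolding set_lebesgue_integral_def
          by (rule integral_eq_zero_AE)
            (use pd False in \<open>auto simp: prob_density_on_def indicator_def\<close>)
        finally show ?thesis .
      qed
      ultimately show ?thesis by (simp only: eq measure_empty)
    qed
  qed
qed

lemma (in passage_from_below) expectation_exp_passage:
  assumes f: "first_passage_density M X S f"
  shows "expectation (\<lambda>\<omega>. exp (- \<theta> * passage \<omega>)) = laplace_on {0..} f \<theta>"
proof -
  have pd: "prob_density_on {0<..} f" using f by (simp add: first_passage_density_def)
  have "expectation (\<lambda>\<omega>. exp (- \<theta> * passage \<omega>)) = (\<integral>x. exp (- \<theta> * x) \<partial>distr M borel passage)"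
    by (subst integral_distr) auto
  also have "\<dots> = (LBINT x. f x *\<^sub>R exp (- \<theta> * x))"
    unfolding distr_passage[OF f] using pd by (intro integral_density) (auto simp: prob_density_on_def)
  also have "\<dots> = laplace_on {0..} f \<theta>"
    unfolding laplace_on_def set_lebesgue_integral_def
    by (rule Bochner_Integration.integral_cong) (use pd in \<open>auto simp: prob_density_on_def indicator_def\<close>)
  finally show ?thesis .
qed

lemma (in prob_space) expectation_exp_density:
  assumes g: "prob_density_on {a<..<S} g" and Y: "distributed M lborel Y g"
  shows "expectation (\<lambda>\<omega>. exp (l * Y \<omega>)) = laplace_on {a..S} g (- l)"
proof -
  have supp: "x \<in> {a..S}" if "g x \<noteq> 0" for x
  proof (rule ccontr)
    assume "x \<notin> {a..S}"
    then have "x \<notin> {a<..<S}" by auto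
    then show False using g that unfolding prob_density_on_def by blast
  qed
  have "expectation (\<lambda>\<omega>. exp (l * Y \<omega>)) = (LBINT x. g x * exp (l * x))"
    by (rule distributed_integral[OF Y, symmetric]) (use g in \<open>auto simp: prob_density_on_def\<close>)
  also have "\<dots> = laplace_on {a..S} g (- l)"
    unfolding laplace_on_def set_lebesgue_integral_def
    by (rule Bochner_Integration.integral_cong) (auto simp: indicator_def dest: supp)
  finally show ?thesis .
qed

text \<open>Optional stopping, rewritten in terms of \<open>f\<close> and \<open>g\<close>.\<close>

lemma ifpt_laplace_identity:
  fixes \<theta> c\<^sub>1 l\<^sub>1 c\<^sub>2 l\<^sub>2 :: real
  assumes X: "reflected_brownian_motion M B \<eta> X L U \<mu> a b" and S: "S \<le> b"
    and sol: "ifpt_solution M \<eta> X a S f g" and \<theta>: "0 \<le> \<theta>"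
    and roots: "l\<^sub>1\<^sup>2 / 2 + \<mu> * l\<^sub>1 = \<theta>" "l\<^sub>2\<^sup>2 / 2 + \<mu> * l\<^sub>2 = \<theta>"
    and neumann: "c\<^sub>1 * l\<^sub>1 * exp (l\<^sub>1 * a) + c\<^sub>2 * l\<^sub>2 * exp (l\<^sub>2 * a) = 0"
  shows "laplace_on {0..} f \<theta> * (c\<^sub>1 * exp (l\<^sub>1 * S) + c\<^sub>2 * exp (l\<^sub>2 * S))
    = c\<^sub>1 * laplace_on {a..S} g (- l\<^sub>1) + c\<^sub>2 * laplace_on {a..S} g (- l\<^sub>2)"
proof -
  interpret reflected_brownian_motion M B \<eta> X L U \<mu> a b by (fact X)
  have g: "prob_density_on {a<..<S} g" and \<eta>: "distributed M lborel \<eta> g" and f: "first_passage_density M X S f"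
    using sol by (auto simp: ifpt_solution_def)
  have "AE \<omega> in M. \<eta> \<omega> \<in> {a<..<S}"
    using g by (subst distributed_AE2[OF \<eta>]) (auto simp: prob_density_on_def intro!: AE_I2)
  then have start: "AE \<omega> in M. X 0 \<omega> < S" using initial by eventually_elim auto
  interpret neumann_eigenfunction M B \<eta> X L U \<mu> a b S \<theta> c\<^sub>1 l\<^sub>1 c\<^sub>2 l\<^sub>2 "\<lambda>x. c\<^sub>1 * exp (l\<^sub>1 * x) + c\<^sub>2 * exp (l\<^sub>2 * x)"
    using S start f \<theta> roots neumann first_passage_density_finite[OF f]
    by unfold_locales (auto simp: first_passage_density_def)
  have exp_int: "integrable M (\<lambda>\<omega>. exp (l * X 0 \<omega>))" for l
    by (rule integrable_const_bound[of _ "exp (\<bar>l\<bar> * max \<bar>a\<bar> \<bar>b\<bar>)"])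
      (use exp_X_bounded[of 0 l] X_measurable[of 0] in auto)
  have exp_mean: "expectation (\<lambda>\<omega>. exp (l * X 0 \<omega>)) = laplace_on {a..S} g (- l)" for l
  proof -
    have "expectation (\<lambda>\<omega>. exp (l * X 0 \<omega>)) = expectation (\<lambda>\<omega>. exp (l * \<eta> \<omega>))"
      by (rule integral_cong_AE) (use X_measurable[of 0] initial_measurable initial in auto)
    then show ?thesis unfolding expectation_exp_density[OF g \<eta>] .
  qed
  show ?thesis
    using passage_identity exp_int unfolding expectation_exp_passage[OF f] by (simp add: exp_mean)
qed

lemma laplace_on_tendsto_at_0:
  assumes f: "prob_density_on {0<..} f"
  shows "(laplace_on {0..} f \<longlongrightarrow> laplace_on {0..} f 0) (at_right 0)"
  unfolding tendsto_at_iff_sequentially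
proof (intro allI impI)
  fix \<theta> :: "nat \<Rightarrow> real" assume \<theta>: "\<forall>i. \<theta> i \<in> {0<..} - {0}" "\<theta> \<longlonglongrightarrow> 0"
  have [measurable]: "f \<in> borel_measurable borel" using f by (simp add: prob_density_on_def)
  show "(laplace_on {0..} f \<circ> \<theta>) \<longlonglongrightarrow> laplace_on {0..} f 0"
    unfolding laplace_on_def set_lebesgue_integral_def comp_def
  proof (rule integral_dominated_convergence[where w = f])
    show "AE x in lborel. (\<lambda>i. indicator {0..} x *\<^sub>R (exp (- \<theta> i * x) * f x))
        \<longlonglongrightarrow> indicator {0..} x *\<^sub>R (exp (- 0 * x) * f x)"
      by (intro AE_I2 tendsto_intros \<theta>)
    show "AE x in lborel. norm (indicator {0..} x *\<^sub>R (exp (- \<theta> i * x) * f x)) \<le> f x" for i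
    proof (rule AE_I2)
      fix x
      have "exp (- \<theta> i * x) * f x \<le> f x" if "0 \<le> x"
        using \<theta>(1)[rule_format, of i] that f
        by (intro mult_left_le_one_le) (auto simp: prob_density_on_def)
      then show "norm (indicator {0..} x *\<^sub>R (exp (- \<theta> i * x) * f x)) \<le> f x"
        using f by (auto simp: prob_density_on_def indicator_def abs_mult)
    qed
  qed (use prob_density_on_integrable[OF f] in auto)
qed

lemma laplace_on_symmetric:
  fixes g :: "real \<Rightarrow> real"
  assumes sym: "\<And>x. g ((p + q) / 2 + x) = g ((p + q) / 2 - x)"
  shows "laplace_on {p..q} g (- \<theta>) = exp ((p + q) * \<theta>) * laplace_on {p..q} g \<theta>"
proof -
  have refl: "g (p + q - x) = g x" for x
  proof -
    have "(p + q) / 2 + ((p + q) / 2 - x) = p + q - x" "(p + q) / 2 - ((p + q) / 2 - x) = x"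
      by (simp_all add: field_simps)
    then show ?thesis using sym[of "(p + q) / 2 - x"] by (simp only:)
  qed
  have "laplace_on {p..q} g (- \<theta>)
      = (LBINT x. indicator {p..q} (p + q + (-1) * x) *\<^sub>R (exp (\<theta> * (p + q + (-1) * x)) * g (p + q + (-1) * x)))"
    unfolding laplace_on_def set_lebesgue_integral_def
    using lborel_integral_real_affine[of "-1" "\<lambda>x. indicator {p..q} x *\<^sub>R (exp (\<theta> * x) * g x)" "p + q"] by simp
  also have "\<dots> = (LBINT x. exp ((p + q) * \<theta>) * (indicator {p..q} x *\<^sub>R (exp (- \<theta> * x) * g x)))"
  proof (rule Bochner_Integration.integral_cong)
    fix x
    have "exp (\<theta> * (p + q + (-1) * x)) = exp ((p + q) * \<theta>) * exp (- \<theta> * x)"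
      by (simp add: exp_add[symmetric] algebra_simps)
    then show "indicator {p..q} (p + q + (-1) * x) *\<^sub>R (exp (\<theta> * (p + q + (-1) * x)) * g (p + q + (-1) * x))
        = exp ((p + q) * \<theta>) * (indicator {p..q} x *\<^sub>R (exp (- \<theta> * x) * g x))"
      using refl[of x] by (auto simp: indicator_def)
  qed simp
  finally show ?thesis by (simp add: laplace_on_def set_lebesgue_integral_def)
qed

section \<open>The necessary condition on a solution\<close>

theorem theorem2p4:
  fixes M :: "'w measure" and B X L U :: "real \<Rightarrow> 'w \<Rightarrow> real" and \<eta> :: "'w \<Rightarrow> real"
    and \<mu> a b S :: real and f g :: "real \<Rightarrow> real"
  assumes "a < b" and "S \<in> {a..b}"
    and "reflected_brownian_motion M B \<eta> X L U \<mu> a b"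
    and "AE \<omega> in M. \<eta> \<omega> \<in> {a..S}"
    and "first_passage_density M X S f"
    and "ifpt_solution M \<eta> X a S f g"
  shows "(let f' = laplace_on {0..} f;
              g' = laplace_on {a..S} g;
              r = (\<lambda>\<theta>. sqrt (\<mu>\<^sup>2 + 2 * \<theta>));
              R = (\<lambda>\<theta>.
                (\<theta> * exp (2 * a * r \<theta>) * g' (r \<theta> + \<mu>)
                  + (\<mu>\<^sup>2 + \<theta> + \<mu> * r \<theta>) * g' (\<mu> - r \<theta>))
                / (\<theta> * exp (- S * (r \<theta> + \<mu>)) * exp (2 * a * r \<theta>)
                  + (\<mu>\<^sup>2 + \<theta> + \<mu> * r \<theta>) * exp (S * (r \<theta> - \<mu>))))
          in (\<forall>\<theta>\<ge>0. \<not> (\<theta> = 0 \<and> \<mu> \<le> 0) \<longrightarrow> f' \<theta> = R \<theta>)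
           \<and> (\<mu> \<le> 0 \<longrightarrow> (R \<longlongrightarrow> f' 0) (at_right 0))
           \<and> (\<mu> = 0 \<longrightarrow> (\<forall>\<theta>\<ge>0. f' \<theta> =
                (g' (sqrt (2 * \<theta>)) + g' (- sqrt (2 * \<theta>)) * exp (- 2 * a * sqrt (2 * \<theta>)))
                / (exp (- S * sqrt (2 * \<theta>)) + exp ((S - 2 * a) * sqrt (2 * \<theta>)))))
           \<and> (\<mu> = 0 \<and> (\<forall>x. g ((a + S) / 2 + x) = g ((a + S) / 2 - x)) \<longrightarrow>
                (\<forall>\<theta>\<ge>0. g' \<theta> =
                  (exp (- S * \<theta>) + exp (- (2 * a - S) * \<theta>)) / (1 + exp ((S - a) * \<theta>))
                  * f' (\<theta>\<^sup>2 / 2))))"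
proof -
  define f' where "f' = laplace_on {0..} f"
  define g' where "g' = laplace_on {a..S} g"
  define r where "r = (\<lambda>\<theta>. sqrt (\<mu>\<^sup>2 + 2 * \<theta>))"
  define k where "k = (\<lambda>\<theta>. \<mu>\<^sup>2 + \<theta> + \<mu> * r \<theta>)"
  define R where "R = (\<lambda>\<theta>. (\<theta> * exp (2 * a * r \<theta>) * g' (r \<theta> + \<mu>) + k \<theta> * g' (\<mu> - r \<theta>))
    / (\<theta> * exp (- S * (r \<theta> + \<mu>)) * exp (2 * a * r \<theta>) + k \<theta> * exp (S * (r \<theta> - \<mu>))))"
  note identity = ifpt_laplace_identity[OF assms(3) _ assms(6), folded f'_def g'_def]
  have S: "S \<le> b" using assms(2) by simp
  have ratio: "f' \<theta> = R \<theta>" if \<theta>: "0 \<le> \<theta>" "\<not> (\<theta> = 0 \<and> \<mu> \<le> 0)" for \<theta>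
  proof -
    have r2: "(r \<theta>)\<^sup>2 = \<mu>\<^sup>2 + 2 * \<theta>" using \<theta>(1) by (simp add: r_def)
    \<comment> \<open>The coefficients \<open>r - \<mu>\<close> and \<open>r + \<mu>\<close> demanded by the boundary condition have been multiplied by
      \<open>(r + \<mu>) / 2\<close>, which turns them into \<open>\<theta>\<close> and \<open>k\<close>.\<close>
    have k_eq: "2 * k \<theta> = (r \<theta> + \<mu>)\<^sup>2"
      using r2 by (simp add: k_def power2_eq_square algebra_simps)
    have k_pos: "0 < k \<theta>"
    proof -
      have "- \<mu> < r \<theta>"
      proof (cases "\<theta> = 0")
        case True
        then show ?thesis using \<theta>(2) by (simp add: r_def)
      next
        case False
        then have "sqrt (\<mu>\<^sup>2) < r \<theta>" using \<theta>(1) unfolding r_def by (intro real_sqrt_less_mono) simp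
        then show ?thesis by simp
      qed
      then show ?thesis using k_eq by (smt (verit) zero_less_power2)
    qed
    have e: "exp (2 * a * r \<theta>) * exp (- (r \<theta> + \<mu>) * a) = exp ((r \<theta> - \<mu>) * a)"
      by (simp add: exp_add[symmetric] algebra_simps)
    have "f' \<theta> * (\<theta> * exp (2 * a * r \<theta>) * exp (- (r \<theta> + \<mu>) * S) + k \<theta> * exp ((r \<theta> - \<mu>) * S))
        = \<theta> * exp (2 * a * r \<theta>) * g' (- (- (r \<theta> + \<mu>))) + k \<theta> * g' (- (r \<theta> - \<mu>))"
    proof (rule identity[OF S \<theta>(1)])
      show "(- (r \<theta> + \<mu>))\<^sup>2 / 2 + \<mu> * - (r \<theta> + \<mu>) = \<theta>" "(r \<theta> - \<mu>)\<^sup>2 / 2 + \<mu> * (r \<theta> - \<mu>) = \<theta>"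
        using r2 by (simp_all add: power2_eq_square field_simps)
      have "\<theta> * (r \<theta> + \<mu>) = k \<theta> * (r \<theta> - \<mu>)"
      proof -
        have "2 * (\<theta> * (r \<theta> + \<mu>)) = ((r \<theta>)\<^sup>2 - \<mu>\<^sup>2) * (r \<theta> + \<mu>)" unfolding r2 by simp
        also have "\<dots> = (r \<theta> + \<mu>)\<^sup>2 * (r \<theta> - \<mu>)" by (simp add: power2_eq_square algebra_simps)
        also have "\<dots> = 2 * (k \<theta> * (r \<theta> - \<mu>))" unfolding k_eq[symmetric] by simp
        finally show ?thesis by simp
      qed
      then show "\<theta> * exp (2 * a * r \<theta>) * - (r \<theta> + \<mu>) * exp (- (r \<theta> + \<mu>) * a)
          + k \<theta> * (r \<theta> - \<mu>) * exp ((r \<theta> - \<mu>) * a) = 0"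
        unfolding e[symmetric] by algebra
    qed
    moreover have "0 < \<theta> * exp (- S * (r \<theta> + \<mu>)) * exp (2 * a * r \<theta>) + k \<theta> * exp (S * (r \<theta> - \<mu>))"
      using \<theta>(1) k_pos by (intro add_nonneg_pos) auto
    moreover have "- (- (r \<theta> + \<mu>)) = r \<theta> + \<mu>" "- (r \<theta> - \<mu>) = \<mu> - r \<theta>"
      "- (r \<theta> + \<mu>) * S = - S * (r \<theta> + \<mu>)" "(r \<theta> - \<mu>) * S = S * (r \<theta> - \<mu>)"
      "\<theta> * exp (2 * a * r \<theta>) * exp (- S * (r \<theta> + \<mu>)) = \<theta> * exp (- S * (r \<theta> + \<mu>)) * exp (2 * a * r \<theta>)"
      by (simp_all add: algebra_simps)
    ultimately show ?thesis
      unfolding R_def by (simp only: eq_divide_eq) simp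
  qed
  have limit: "(R \<longlongrightarrow> f' 0) (at_right 0)"
  proof (rule Lim_transform_eventually)
    show "(f' \<longlongrightarrow> f' 0) (at_right 0)"
      unfolding f'_def using assms(5) by (intro laplace_on_tendsto_at_0) (simp add: first_passage_density_def)
    show "\<forall>\<^sub>F \<theta> in at_right 0. f' \<theta> = R \<theta>"
      using ratio by (auto simp: eventually_at_filter)
  qed
  have driftless: "f' \<theta> = (g' (sqrt (2 * \<theta>)) + g' (- sqrt (2 * \<theta>)) * exp (- 2 * a * sqrt (2 * \<theta>)))
      / (exp (- S * sqrt (2 * \<theta>)) + exp ((S - 2 * a) * sqrt (2 * \<theta>)))"
    if \<mu>: "\<mu> = 0" and \<theta>: "0 \<le> \<theta>" for \<theta>
  proof -
    define q where "q = sqrt (2 * \<theta>)"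
    have "f' \<theta> * (1 * exp (- q * S) + exp (- 2 * a * q) * exp (q * S))
        = 1 * g' (- (- q)) + exp (- 2 * a * q) * g' (- q)"
    proof (rule identity[OF S \<theta>])
      show "(- q)\<^sup>2 / 2 + \<mu> * - q = \<theta>" "q\<^sup>2 / 2 + \<mu> * q = \<theta>" using \<theta> by (simp_all add: q_def \<mu>)
      have "exp (- 2 * a * q) * exp (q * a) = exp (- q * a)" by (simp add: exp_add[symmetric])
      then have "exp (- 2 * a * q) * q * exp (q * a) = q * exp (- q * a)"
        by (metis mult.assoc mult.commute)
      then show "1 * - q * exp (- q * a) + exp (- 2 * a * q) * q * exp (q * a) = 0" by simp
    qed
    moreover have "exp (- 2 * a * q) * exp (q * S) = exp ((S - 2 * a) * q)"
      by (simp add: exp_add[symmetric] algebra_simps)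
    moreover have "0 < exp (- S * q) + exp ((S - 2 * a) * q)" by (simp add: add_pos_pos)
    ultimately show ?thesis unfolding q_def[symmetric] by (simp add: eq_divide_eq mult_ac)
  qed
  have symmetric: "g' \<theta> = (exp (- S * \<theta>) + exp (- (2 * a - S) * \<theta>)) / (1 + exp ((S - a) * \<theta>)) * f' (\<theta>\<^sup>2 / 2)"
    if \<mu>: "\<mu> = 0" and sym: "\<And>x. g ((a + S) / 2 + x) = g ((a + S) / 2 - x)" and \<theta>: "0 \<le> \<theta>" for \<theta>
  proof -
    have q: "sqrt (2 * (\<theta>\<^sup>2 / 2)) = \<theta>" using \<theta> by simp
    have e: "exp ((a + S) * \<theta>) * exp (- 2 * a * \<theta>) = exp ((S - a) * \<theta>)"
      by (simp add: exp_add[symmetric] algebra_simps)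
    have "g' (- \<theta>) * exp (- 2 * a * \<theta>) = g' \<theta> * exp ((S - a) * \<theta>)"
      unfolding g'_def laplace_on_symmetric[OF sym] e[symmetric] by simp
    then have "f' (\<theta>\<^sup>2 / 2) = g' \<theta> * (1 + exp ((S - a) * \<theta>)) / (exp (- S * \<theta>) + exp ((S - 2 * a) * \<theta>))"
      using driftless[OF \<mu>, of "\<theta>\<^sup>2 / 2"] unfolding q by (simp add: algebra_simps)
    moreover have "- (2 * a - S) * \<theta> = (S - 2 * a) * \<theta>" by simp
    moreover have "0 < exp (- S * \<theta>) + exp ((S - 2 * a) * \<theta>)" "0 < 1 + exp ((S - a) * \<theta>)"
      by (simp_all add: add_pos_pos)
    ultimately show ?thesis by simp
  qed
  show ?thesis
    unfolding Let_def f'_def[symmetric] g'_def[symmetric]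
    using ratio limit driftless symmetric unfolding R_def k_def r_def by blast
qed

end
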